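(* Let $d\ge1$ be an integer. For each of the four settings (I), (I* ), (II), (II* ) under (A1), with associated constant $q\in\{1,2,4\}$, there exists an objective function $F$ (on some $d$-dimensional $\Theta$) such that, for any step-size $s>0$, the iterates $(f_k)_{k\ge0}$ of the Proximal Gradient Method (PGM) with distance-generating function $\eta_2(u)=u^2/2$, initialized with $f_0=1$, satisfy $$F(f_k)-\inf F\gtrsim k^{-\frac{q}{d+q}},$$ i.e. there exists $c>0$ independent of $k$ such that $F(f_k)-\inf F\ge c\,k^{-q/(d+q)}$ for all $k\ge1$.
   Context: $\Theta$ is a compact $d$-dimensional Riemannian manifold without boundary, with geodesic distance $\mathrm{dist}$, and $\tau$ is the probability measure on $\Theta$ proportional to the volume measure. $\mathcal{M}(\Theta)$ (resp. $\mathcal{M}_+(\Theta)$, $\mathcal{P}(\Theta)$) is the set of finite signed (resp. finite nonnegative, probability) Borel measures on $\Theta$, and $\|\mu\|$ is the total variation norm. $\iota_C$ is the convex indicator of $C$. Objective: $\bar F=\bar G+\bar H:\mathcal{M}(\Theta)\to\mathbb{R}\cup\{+\infty\}$ with $\bar G(\mu)=R\big(\int\Phi\,\mathrm{d}\mu\big)$, under (A1): $\Phi\in\mathcal{C}^0(\Theta;\mathcal{F})$ where $\mathcal{F}$ is a Hilbert space; $R:\mathcal{F}\to\mathbb{R}$ is convex and differentiable with Lipschitz gradient $\nabla R$; $\bar H$ is a sum of functions from the list $\iota_{\mathcal{P}(\Theta)}$, $\iota_{\mathcal{M}_+(\Theta)}$, $\mu\mapsto\lambda\|\mu\|$, $\iota_{\{\mu:\lambda\|\mu\|\le1\}}$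 (with $\lambda\ge0$). For $f\in L^1(\tau)$: $F(f)=\bar F(f\tau)$, $G(f)=\bar G(f\tau)$, $H(f)=\bar H(f\tau)$, and $\inf F=\inf_{L^1(\tau)}F$. The differential of $\bar G$ at $\mu$ is represented by the function $\bar G'[\mu](\theta)=\langle\nabla R(\int\Phi\,\mathrm{d}\mu),\Phi(\theta)\rangle_{\mathcal{F}}$, and $G'[f]=\bar G'[f\tau]$. Settings: in each of them there is $\mu^*\in\mathcal{M}(\Theta)$ with $\bar F(\mu^* )=\inf F$, and (I): $\Phi$ Lipschitz, $\bar G'[\mu^*]$ arbitrary; $q=1$. (I* ): $\Phi$ Lipschitz and $\bar G'[\mu^*]=0$; $q=2$. (II): $\nabla_\theta\Phi$ Lipschitz (i.e. $\Phi$ is $\mathcal{C}^1$ with Lipschitz derivative), $\bar G'[\mu^*]$ arbitrary; $q=2$. (II* ): $\nabla_\theta\Phi$ Lipschitz and $\bar G'[\mu^*]=0$; $q=4$. PGM with distance-generating function $\eta$ and step-size $s>0$: given $f_0\in\operatorname{dom}H$, for $k=0,1,\dots$ $$f_{k+1}=\arg\min_{f\in L^1(\tau)}\Big\{G(f_k)+\int G'[f_k](f-f_k)\,\mathrm{d}\tau+H(f)+\tfrac1sD_{\bar\eta}(f,f_k)\Big\},$$ where $D_{\bar\eta}(f,g)=\int_\Theta\big(\eta(f)-\eta(g)-\eta'(g)(f-g)\big)\mathrm{d}\tau$; for $\eta=\eta_2$, $D_{\bar\eta_2}(f,g)=\frac12\int|f-g|^2\,\mathrm{d}\tau$. *)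

theory Defs
  imports "HOL-Analysis.Analysis"
begin

section \<open>The Hilbert space of square-summable sequences\<close>

text \<open>
  The feature space of an objective is a Hilbert space that may be chosen freely. A formula cannot
  quantify over types, so this space is fixed here to be the infinite-dimensional separable Hilbert
  space. No objective is lost: the image of a continuous feature map on a compact space spans
  a separable subspace, which embeds isometrically as a closed subspace V of this space,
  and a loss on V extends by composition with the orthogonal projection onto V.
\<close>

typedef ell2 = "{x :: nat \<Rightarrow> real. summable (\<lambda>n. (x n)\<^sup>2)}"
  morphisms coord Abs_ell2
  by (rule exI[of _ "\<lambda>_. 0"]) simp

setup_lifting type_definition_ell2

lemma summable_coord: "summable (\<lambda>n. (coord x n)\<^sup>2)"
  using coord[of x] by simp

lemma summable_mult_square:
  fixes x y :: "nat \<Rightarrow> real"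
  assumes "summable (\<lambda>n. (x n)\<^sup>2)" "summable (\<lambda>n. (y n)\<^sup>2)"
  shows "summable (\<lambda>n. x n * y n)"
proof (rule summable_comparison_test'[where N = 0])
  show "summable (\<lambda>n. (x n)\<^sup>2 + (y n)\<^sup>2)" using assms by (rule summable_add)
  fix n
  have "2 * \<bar>x n * y n\<bar> \<le> (x n)\<^sup>2 + (y n)\<^sup>2"
    using sum_squares_bound[of "\<bar>x n\<bar>" "\<bar>y n\<bar>"] by (simp add: abs_mult mult.assoc)
  moreover have "0 \<le> (x n)\<^sup>2 + (y n)\<^sup>2" by simp
  ultimately show "norm (x n * y n) \<le> (x n)\<^sup>2 + (y n)\<^sup>2"
    unfolding real_norm_def by linarith
qed

lemma summable_add_square:
  fixes x y :: "nat \<Rightarrow> real"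
  assumes "summable (\<lambda>n. (x n)\<^sup>2)" "summable (\<lambda>n. (y n)\<^sup>2)"
  shows "summable (\<lambda>n. (x n + y n)\<^sup>2)"
proof -
  have "summable (\<lambda>n. (x n)\<^sup>2 + (y n)\<^sup>2 + 2 * (x n * y n))"
    by (intro summable_add summable_mult summable_mult_square assms)
  then show ?thesis by (simp add: power2_sum mult.assoc)
qed

lemma summable_scale_square:
  fixes x :: "nat \<Rightarrow> real"
  assumes "summable (\<lambda>n. (x n)\<^sup>2)"
  shows "summable (\<lambda>n. (r * x n)\<^sup>2)"
  using summable_mult[OF assms, of "r\<^sup>2"] by (simp add: power_mult_distrib)

instantiation ell2 :: real_vector
begin

lift_definition zero_ell2 :: ell2 is "\<lambda>_. 0" by simp
lift_definition plus_ell2 :: "ell2 \<Rightarrow> ell2 \<Rightarrow> ell2" is "\<lambda>x y n. x n + y n"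
  by (rule summable_add_square)
lift_definition uminus_ell2 :: "ell2 \<Rightarrow> ell2" is "\<lambda>x n. - x n" by simp
lift_definition minus_ell2 :: "ell2 \<Rightarrow> ell2 \<Rightarrow> ell2" is "\<lambda>x y n. x n - y n"
proof -
  fix x y :: "nat \<Rightarrow> real"
  assume "summable (\<lambda>n. (x n)\<^sup>2)" "summable (\<lambda>n. (y n)\<^sup>2)"
  then show "summable (\<lambda>n. (x n - y n)\<^sup>2)"
    using summable_add_square[of x "\<lambda>n. - y n"] by simp
qed
lift_definition scaleR_ell2 :: "real \<Rightarrow> ell2 \<Rightarrow> ell2" is "\<lambda>r x n. r * x n"
  by (rule summable_scale_square)
instance
proof
  fix x y z :: ell2 and r s :: real
  show "x + y + z = x + (y + z)" by transfer (simp add: add.assoc)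
  show "x + y = y + x" by transfer (simp add: add.commute)
  show "0 + x = x" by transfer simp
  show "- x + x = 0" by transfer simp
  show "x - y = x + - y" by transfer simp
  show "r *\<^sub>R (x + y) = r *\<^sub>R x + r *\<^sub>R y" by transfer (simp add: algebra_simps)
  show "(r + s) *\<^sub>R x = r *\<^sub>R x + s *\<^sub>R x" by transfer (simp add: algebra_simps)
  show "r *\<^sub>R s *\<^sub>R x = (r * s) *\<^sub>R x" by transfer (simp add: mult.assoc)
  show "1 *\<^sub>R x = x" by transfer simp
qed

end

instantiation ell2 :: real_inner
begin

lift_definition inner_ell2 :: "ell2 \<Rightarrow> ell2 \<Rightarrow> real" is "\<lambda>x y. \<Sum>n. x n * y n" .

definition "norm_ell2 (x :: ell2) = sqrt (inner x x)"
definition "dist_ell2 (x :: ell2) y = norm (x - y)"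
definition "sgn_ell2 (x :: ell2) = x /\<^sub>R norm x"
definition "uniformity_ell2 = (INF e\<in>{0<..}. principal {(x :: ell2, y). dist x y < e})"
definition "open_ell2 (S :: ell2 set) = (\<forall>x\<in>S. \<forall>\<^sub>F (x', y) in uniformity. x' = x \<longrightarrow> y \<in> S)"

instance
proof
  fix x y z :: ell2 and r :: real
  show "dist x y = norm (x - y)" by (rule dist_ell2_def)
  show "sgn x = x /\<^sub>R norm x" by (rule sgn_ell2_def)
  show "uniformity = (INF e\<in>{0<..}. principal {(x :: ell2, y). dist x y < e})"
    by (rule uniformity_ell2_def)
  show "open S = (\<forall>x\<in>S. \<forall>\<^sub>F (x', y) in uniformity. x' = x \<longrightarrow> y \<in> S)" for S :: "ell2 set"
    by (rule open_ell2_def)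
  show "inner x y = inner y x" by transfer (simp add: mult.commute)
  show "inner (x + y) z = inner x z + inner y z"
    by transfer (simp add: distrib_right suminf_add[symmetric] summable_mult_square)
  show "inner (r *\<^sub>R x) y = r * inner x y"
    by transfer (simp add: mult.assoc suminf_mult summable_mult_square)
  show "0 \<le> inner x x"
    by transfer (simp add: suminf_nonneg flip: power2_eq_square)
  show "inner x x = 0 \<longleftrightarrow> x = 0"
    by transfer (auto simp: suminf_eq_zero_iff fun_eq_iff simp flip: power2_eq_square)
  show "norm x = sqrt (inner x x)" by (rule norm_ell2_def)
qed

end

lemma norm_ell2_square: "(norm x)\<^sup>2 = (\<Sum>n. (coord x n)\<^sup>2)"
proof -
  have "inner x x = (\<Sum>n. (coord x n)\<^sup>2)" by transfer (simp add: power2_eq_square)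
  then show ?thesis by (simp add: power2_norm_eq_inner)
qed

lemma sum_coord_le: "(\<Sum>n<N. (coord x n)\<^sup>2) \<le> (norm x)\<^sup>2"
  unfolding norm_ell2_square by (rule sum_le_suminf) (auto simp: summable_coord)

lemma abs_coord_le: "\<bar>coord x n\<bar> \<le> norm x"
proof -
  have "(coord x n)\<^sup>2 \<le> (\<Sum>n<Suc n. (coord x n)\<^sup>2)" by (simp add: sum_nonneg)
  also have "\<dots> \<le> (norm x)\<^sup>2" by (rule sum_coord_le)
  finally show ?thesis by (simp add: power2_le_iff_abs_le)
qed

lemma coord_minus: "coord (x - y) n = coord x n - coord y n"
  by transfer simp

instance ell2 :: complete_space
proof
  fix X :: "nat \<Rightarrow> ell2"
  assume X: "Cauchy X"
  have "Cauchy (\<lambda>k. coord (X k) n)" for n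
  proof (rule CauchyI)
    fix e :: real assume "0 < e"
    then obtain M where "\<And>m k. m \<ge> M \<Longrightarrow> k \<ge> M \<Longrightarrow> norm (X m - X k) < e"
      using CauchyD[OF X] by blast
    then show "\<exists>M. \<forall>m\<ge>M. \<forall>k\<ge>M. norm (coord (X m) n - coord (X k) n) < e"
      using abs_coord_le[of "X _ - X _" n] unfolding coord_minus real_norm_def
      by (meson le_less_trans)
  qed
  then have "\<forall>n. \<exists>l. (\<lambda>k. coord (X k) n) \<longlonglongrightarrow> l"
    by (simp add: Cauchy_convergent_iff convergent_def)
  then obtain L where L: "\<And>n. (\<lambda>k. coord (X k) n) \<longlonglongrightarrow> L n" by metis
  have tail: "\<exists>M. \<forall>m\<ge>M. \<forall>N. (\<Sum>n<N. (coord (X m) n - L n)\<^sup>2) \<le> e\<^sup>2" if "0 < e" for e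
  proof -
    obtain M where M: "\<And>m k. m \<ge> M \<Longrightarrow> k \<ge> M \<Longrightarrow> norm (X m - X k) < e"
      using CauchyD[OF X \<open>0 < e\<close>] by blast
    have "(\<Sum>n<N. (coord (X m) n - L n)\<^sup>2) \<le> e\<^sup>2" if "m \<ge> M" for m N
    proof (rule LIMSEQ_le_const2)
      show "(\<lambda>k. \<Sum>n<N. (coord (X m) n - coord (X k) n)\<^sup>2) \<longlonglongrightarrow> (\<Sum>n<N. (coord (X m) n - L n)\<^sup>2)"
        by (intro tendsto_intros L)
      have "(\<Sum>n<N. (coord (X m) n - coord (X k) n)\<^sup>2) \<le> e\<^sup>2" if "k \<ge> M" for k
      proof -
        have "(\<Sum>n<N. (coord (X m) n - coord (X k) n)\<^sup>2) \<le> (norm (X m - X k))\<^sup>2"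
          using sum_coord_le[where x = "X m - X k"] by (simp add: coord_minus)
        also have "\<dots> \<le> e\<^sup>2" using M[OF \<open>m \<ge> M\<close> that] by (intro power_mono) auto
        finally show ?thesis .
      qed
      then show "\<exists>K. \<forall>k\<ge>K. (\<Sum>n<N. (coord (X m) n - coord (X k) n)\<^sup>2) \<le> e\<^sup>2" by blast
    qed
    then show ?thesis by blast
  qed
  have sq: "summable (\<lambda>n. (coord (X m) n - L n)\<^sup>2)"
    if "\<forall>N. (\<Sum>n<N. (coord (X m) n - L n)\<^sup>2) \<le> b" for m b
    using that by (intro summableI_nonneg_bounded[where x = b]) auto
  obtain M1 where M1: "\<forall>N. (\<Sum>n<N. (coord (X M1) n - L n)\<^sup>2) \<le> 1\<^sup>2"
    using tail[of 1] by auto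
  have "summable (\<lambda>n. (L n)\<^sup>2)"
    using summable_add_square[OF summable_coord[of "X M1"]
        summable_scale_square[OF sq[OF M1], of "- 1"]] by simp
  then obtain l where l: "coord l = L"
    using Abs_ell2_inverse[of L] by auto
  have "X \<longlonglongrightarrow> l"
  proof (rule metric_LIMSEQ_I)
    fix r :: real assume "0 < r"
    then obtain M where M: "\<And>m N. m \<ge> M \<Longrightarrow> (\<Sum>n<N. (coord (X m) n - L n)\<^sup>2) \<le> (r / 2)\<^sup>2"
      using tail[of "r / 2"] by auto
    have "dist (X m) l < r" if "m \<ge> M" for m
    proof -
      have "(norm (X m - l))\<^sup>2 = (\<Sum>n. (coord (X m) n - L n)\<^sup>2)"
        by (simp add: norm_ell2_square coord_minus l)
      also have "\<dots> \<le> (r / 2)\<^sup>2"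
        using M[OF that] by (intro suminf_le_const sq) auto
      finally have "norm (X m - l) \<le> r / 2"
        using \<open>0 < r\<close> by (simp add: power2_le_iff_abs_le)
      then show ?thesis using \<open>0 < r\<close> by (simp add: dist_norm)
    qed
    then show "\<exists>M. \<forall>m\<ge>M. dist (X m) l < r" by blast
  qed
  then show "convergent X" by (rule convergentI)
qed

instance ell2 :: banach ..

lift_definition finite_ell2 :: "real list \<Rightarrow> ell2" is
  "\<lambda>xs n. if n < length xs then xs ! n else 0"
proof -
  fix xs :: "real list"
  show "summable (\<lambda>n. (if n < length xs then xs ! n else 0)\<^sup>2)"
    by (rule summable_finite[of "{..<length xs}"]) auto
qed

lemma rational_sequences_dense:
  assumes "0 < e"
  shows "\<exists>xs. set xs \<subseteq> \<rat> \<and> dist x (finite_ell2 xs) < e"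
proof -
  obtain N where N: "norm (\<Sum>n. (coord x (n + N))\<^sup>2) < e\<^sup>2 / 2"
    using suminf_exist_split[OF _ summable_coord[of x], of "e\<^sup>2 / 2"] assms by auto
  have "\<exists>q\<in>\<rat>. (coord x n - q)\<^sup>2 \<le> e\<^sup>2 / (2 * (N + 1))" for n
  proof -
    define d where "d = e / sqrt (2 * (N + 1))"
    have "d > 0" using assms by (simp add: d_def)
    then obtain q where q: "q \<in> \<rat>" "coord x n < q" "q < coord x n + d"
      using Rats_dense_in_real[of "coord x n" "coord x n + d"] by auto
    then have "(coord x n - q)\<^sup>2 \<le> d\<^sup>2"
      using \<open>d > 0\<close> by (subst power2_le_iff_abs_le) auto
    also have "d\<^sup>2 = e\<^sup>2 / (2 * (N + 1))" by (simp add: d_def power_divide)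
    finally show ?thesis using q by auto
  qed
  then obtain q where q: "\<And>n. q n \<in> \<rat>" "\<And>n. (coord x n - q n)\<^sup>2 \<le> e\<^sup>2 / (2 * (N + 1))"
    by metis
  define xs where "xs = map q [0..<N]"
  have c: "coord (finite_ell2 xs) n = (if n < N then q n else 0)" for n
    by (simp add: finite_ell2.rep_eq xs_def)
  have "(norm (x - finite_ell2 xs))\<^sup>2
    = (\<Sum>n. (coord (x - finite_ell2 xs) (n + N))\<^sup>2) + (\<Sum>n<N. (coord (x - finite_ell2 xs) n)\<^sup>2)"
    unfolding norm_ell2_square by (rule suminf_split_initial_segment[OF summable_coord])
  also have "(\<Sum>n. (coord (x - finite_ell2 xs) (n + N))\<^sup>2) = (\<Sum>n. (coord x (n + N))\<^sup>2)"
    by (simp add: coord_minus c)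
  also have "\<dots> < e\<^sup>2 / 2" using N by simp
  also have "(\<Sum>n<N. (coord (x - finite_ell2 xs) n)\<^sup>2) = (\<Sum>n<N. (coord x n - q n)\<^sup>2)"
    by (simp add: coord_minus c)
  also have "\<dots> \<le> (\<Sum>n<N. e\<^sup>2 / (2 * (N + 1)))" by (intro sum_mono q)
  also have "\<dots> \<le> e\<^sup>2 / 2" by (simp add: field_simps)
  finally have "(norm (x - finite_ell2 xs))\<^sup>2 < e\<^sup>2" by simp
  then have "norm (x - finite_ell2 xs) < e"
    using assms by (simp add: power2_less_imp_less)
  moreover have "set xs \<subseteq> \<rat>" using q by (auto simp: xs_def)
  ultimately show ?thesis by (auto simp: dist_norm)
qed

instance ell2 :: second_countable_topology
proof
  define D where "D = finite_ell2 ` lists \<rat>"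
  define B where "B = (\<lambda>(c, r). ball c r) ` (D \<times> (\<rat> :: real set))"
  have "countable B"
    unfolding B_def D_def by (intro countable_image countable_SIGMA countable_lists countable_rat)
  moreover have "topological_basis B"
  proof (rule topological_basisI)
    show "open b" if "b \<in> B" for b using that by (auto simp: B_def)
    fix S :: "ell2 set" and x assume "open S" "x \<in> S"
    then obtain e where e: "e > 0" "ball x e \<subseteq> S" by (auto simp: open_contains_ball)
    obtain r where r: "r \<in> \<rat>" "e / 3 < r" "r < e / 2"
      using Rats_dense_in_real[of "e / 3" "e / 2"] e by auto
    have "\<exists>c\<in>D. dist x c < e / 3"
      using rational_sequences_dense[of "e / 3" x] e by (auto simp: D_def lists_eq_set)
    then obtain c where c: "c \<in> D" "dist x c < e / 3" by blast
    have "ball c r \<subseteq> ball x e"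
    proof
      fix y assume "y \<in> ball c r"
      then show "y \<in> ball x e"
        using dist_triangle[of x y c] c r e by simp
    qed
    moreover have "x \<in> ball c r" using c r by (simp add: dist_commute)
    moreover have "ball c r \<in> B" using c r by (auto simp: B_def)
    ultimately show "\<exists>b\<in>B. x \<in> b \<and> b \<subseteq> S" using e by blast
  qed
  ultimately show "\<exists>B :: ell2 set set. countable B \<and> open = generate_topology B"
    by (blast intro: topological_basis_imp_subbasis)
qed


section \<open>Compact Riemannian manifolds\<close>

text \<open>For open S.\<close>

primrec Ck_on ::
  "nat \<Rightarrow> ('a::real_normed_vector \<Rightarrow> 'b::real_normed_vector) \<Rightarrow> 'a set \<Rightarrow> bool" where
  "Ck_on 0 f S \<longleftrightarrow> continuous_on S f"
| "Ck_on (Suc k) f S \<longleftrightarrow> (\<forall>x\<in>S. f differentiable (at x)) \<and>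
     (\<forall>v. Ck_on k (\<lambda>x. frechet_derivative f (at x) v) S)"

definition smooth_on :: "('a::real_normed_vector \<Rightarrow> 'b::real_normed_vector) \<Rightarrow> 'a set \<Rightarrow> bool" where
  "smooth_on f S \<longleftrightarrow> (\<forall>k. Ck_on k f S)"

text \<open>
  A chart is a pair (U, phi) of a domain and a coordinate map into d-dimensional space, where d is
  the cardinality of the index type. The field gram gives, for each chart, the matrix of the
  Riemannian metric at each point of the chart image. The topology of the manifold is abstract,
  so the type of its points carries no meaning.
\<close>

type_synonym ('p, 'n) chart = "'p set \<times> ('p \<Rightarrow> real^'n)"

record ('p, 'n) manifold =
  mtop :: "'p topology"
  charts :: "('p, 'n) chart set"
  gram :: "('p, 'n) chart \<Rightarrow> real^'n \<Rightarrow> real^'n^'n"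

abbreviation chart_image :: "('p, 'n) chart \<Rightarrow> (real^'n) set" where
  "chart_image c \<equiv> snd c ` fst c"

abbreviation chart_inv :: "('p, 'n) chart \<Rightarrow> real^'n \<Rightarrow> 'p" where
  "chart_inv c \<equiv> inv_into (fst c) (snd c)"

abbreviation chart_transition :: "('p, 'n) chart \<Rightarrow> ('p, 'n) chart \<Rightarrow> real^'n \<Rightarrow> real^'n" where
  "chart_transition c c' \<equiv> snd c' \<circ> chart_inv c"

definition smooth_atlas :: "('p, 'n::finite) manifold \<Rightarrow> bool" where
  "smooth_atlas M \<longleftrightarrow>
     \<Union>(fst ` charts M) = topspace (mtop M) \<and>
     (\<forall>c\<in>charts M. openin (mtop M) (fst c) \<and> open (chart_image c) \<and>
        homeomorphic_map (subtopology (mtop M) (fst c)) (top_of_set (chart_image c)) (snd c)) \<and>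
     (\<forall>c\<in>charts M. \<forall>c'\<in>charts M.
        smooth_on (chart_transition c c') (snd c ` (fst c \<inter> fst c')))"

definition riemannian_metric :: "('p, 'n::finite) manifold \<Rightarrow> bool" where
  "riemannian_metric M \<longleftrightarrow>
     (\<forall>c\<in>charts M. smooth_on (gram M c) (chart_image c) \<and>
        (\<forall>x\<in>chart_image c. transpose (gram M c x) = gram M c x \<and>
           (\<forall>v. v \<noteq> 0 \<longrightarrow> 0 < v \<bullet> (gram M c x *v v)))) \<and>
     (\<forall>c\<in>charts M. \<forall>c'\<in>charts M. \<forall>x\<in>snd c ` (fst c \<inter> fst c'). \<forall>u v.
        let D = frechet_derivative (chart_transition c c') (at x)
        in u \<bullet> (gram M c x *v v) = D u \<bullet> (gram M c' (chart_transition c c' x) *v D v))"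

text \<open>
  Charts map onto open subsets of the full space, so there is no boundary. Connectedness makes the
  geodesic distance finite. Second countability follows from compactness.
\<close>

definition compact_riemannian_manifold :: "('p, 'n::finite) manifold \<Rightarrow> bool" where
  "compact_riemannian_manifold M \<longleftrightarrow>
     topspace (mtop M) \<noteq> {} \<and> Hausdorff_space (mtop M) \<and> compact_space (mtop M) \<and>
     connected_space (mtop M) \<and> smooth_atlas M \<and> riemannian_metric M"

text \<open>
  Lengths of piecewise continuously differentiable curves from x, each piece lying in one chart.
  In the second rule, g and g' are the coordinate expression of the last piece and its velocity.
\<close>

inductive curve_length :: "('p, 'n::finite) manifold \<Rightarrow> 'p \<Rightarrow> 'p \<Rightarrow> real \<Rightarrow> bool"
  for M and x where
  const: "x \<in> topspace (mtop M) \<Longrightarrow> curve_length M x x 0"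
| piece: "\<lbrakk>curve_length M x y l; c \<in> charts M; y \<in> fst c; z \<in> fst c;
     g ` {0..1} \<subseteq> chart_image c; g 0 = snd c y; g 1 = snd c z;
     \<And>t. t \<in> {0..1} \<Longrightarrow> (g has_vector_derivative g' t) (at t within {0..1});
     continuous_on {0..1} g'\<rbrakk>
   \<Longrightarrow> curve_length M x z
         (l + integral {0..1} (\<lambda>t :: real. sqrt (g' t \<bullet> (gram M c (g t) *v g' t))))"

definition geodesic_dist :: "('p, 'n::finite) manifold \<Rightarrow> 'p \<Rightarrow> 'p \<Rightarrow> real" where
  "geodesic_dist M x y = Inf {l. curve_length M x y l}"

definition manifold_borel :: "('p, 'n::finite) manifold \<Rightarrow> 'p measure" where
  "manifold_borel M = sigma (topspace (mtop M)) {U. openin (mtop M) U}"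

definition volume_measure :: "('p, 'n::finite) manifold \<Rightarrow> 'p measure \<Rightarrow> bool" where
  "volume_measure M \<nu> \<longleftrightarrow>
     space \<nu> = space (manifold_borel M) \<and> sets \<nu> = sets (manifold_borel M) \<and>
     (\<forall>c\<in>charts M. \<forall>A\<in>sets \<nu>. A \<subseteq> fst c \<longrightarrow>
        emeasure \<nu> A =
          (\<integral>\<^sup>+x. ennreal (sqrt (det (gram M c x))) * indicator (snd c ` A) x \<partial>lborel))"

definition normalized_volume :: "('p, 'n::finite) manifold \<Rightarrow> 'p measure \<Rightarrow> bool" where
  "normalized_volume M \<tau> \<longleftrightarrow>
     (\<exists>\<nu>. volume_measure M \<nu> \<and> \<tau> = scale_measure (1 / emeasure \<nu> (space \<nu>)) \<nu>)"

definition Lipschitz_map ::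
  "('p, 'n::finite) manifold \<Rightarrow> ('p \<Rightarrow> 'h::metric_space) \<Rightarrow> bool" where
  "Lipschitz_map M \<Phi> \<longleftrightarrow>
     (\<exists>L. \<forall>x\<in>topspace (mtop M). \<forall>y\<in>topspace (mtop M).
        dist (\<Phi> x) (\<Phi> y) \<le> L * geodesic_dist M x y)"

text \<open>
  Continuously differentiable with Lipschitz derivative. Derivatives at different points are
  compared in coordinates, and a chart controls the geometry only on compact subsets of its image.
  As the manifold is compact, this depends neither on the atlas nor on the metric.
\<close>

definition Lipschitz_derivative ::
  "('p, 'n::finite) manifold \<Rightarrow> ('p \<Rightarrow> 'h::real_normed_vector) \<Rightarrow> bool" where
  "Lipschitz_derivative M \<Phi> \<longleftrightarrow>
     (\<forall>c\<in>charts M. \<exists>D :: real^'n \<Rightarrow> (real^'n) \<Rightarrow>\<^sub>L 'h.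
        (\<forall>x\<in>chart_image c.
           ((\<Phi> \<circ> chart_inv c) has_derivative blinfun_apply (D x)) (at x)) \<and>
        (\<forall>K. compact K \<and> K \<subseteq> chart_image c \<longrightarrow> (\<exists>L. L-lipschitz_on K D)))"


section \<open>Finite signed measures\<close>

text \<open>
  A finite signed measure is a countably additive real set function. In this section S only
  contributes its space and sigma-algebra, and only values on measurable sets are relevant.
\<close>

definition signed_measure :: "'p measure \<Rightarrow> ('p set \<Rightarrow> real) \<Rightarrow> bool" where
  "signed_measure S \<mu> \<longleftrightarrow> \<mu> {} = 0 \<and>
     (\<forall>A. range A \<subseteq> sets S \<longrightarrow> disjoint_family A \<longrightarrow> (\<lambda>i::nat. \<mu> (A i)) sums \<mu> (\<Union>i. A i))"

text \<open>The two parts of the Jordan decomposition are those of \<mu> and of its negative.\<close>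

definition positive_part :: "'p measure \<Rightarrow> ('p set \<Rightarrow> real) \<Rightarrow> 'p measure" where
  "positive_part S \<mu> =
     measure_of (space S) (sets S) (\<lambda>A. ennreal (SUP B\<in>{B\<in>sets S. B \<subseteq> A}. \<mu> B))"

abbreviation negative_part :: "'p measure \<Rightarrow> ('p set \<Rightarrow> real) \<Rightarrow> 'p measure" where
  "negative_part S \<mu> \<equiv> positive_part S (\<lambda>A. - \<mu> A)"

definition signed_integral ::
  "'p measure \<Rightarrow> ('p set \<Rightarrow> real) \<Rightarrow> ('p \<Rightarrow> 'h::{banach, second_countable_topology}) \<Rightarrow> 'h" where
  "signed_integral S \<mu> \<Phi> =
     (\<integral>\<theta>. \<Phi> \<theta> \<partial>positive_part S \<mu>) - (\<integral>\<theta>. \<Phi> \<theta> \<partial>negative_part S \<mu>)"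

definition tv_norm :: "'p measure \<Rightarrow> ('p set \<Rightarrow> real) \<Rightarrow> real" where
  "tv_norm S \<mu> = measure (positive_part S \<mu>) (space S) + measure (negative_part S \<mu>) (space S)"

definition density_measure :: "'p measure \<Rightarrow> ('p \<Rightarrow> real) \<Rightarrow> 'p set \<Rightarrow> real" where
  "density_measure \<tau> f A = (LINT \<theta>:A|\<tau>. f \<theta>)"


section \<open>Objectives\<close>

definition convex_indicator :: "'a set \<Rightarrow> 'a \<Rightarrow> ereal" where
  "convex_indicator C \<mu> = (if \<mu> \<in> C then 0 else \<infinity>)"

definition nonneg_measures :: "'p measure \<Rightarrow> ('p set \<Rightarrow> real) set" where
  "nonneg_measures S = {\<mu>. signed_measure S \<mu> \<and> (\<forall>A\<in>sets S. 0 \<le> \<mu> A)}"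

definition prob_measures :: "'p measure \<Rightarrow> ('p set \<Rightarrow> real) set" where
  "prob_measures S = {\<mu>\<in>nonneg_measures S. \<mu> (space S) = 1}"

definition elementary_regularizers :: "'p measure \<Rightarrow> (('p set \<Rightarrow> real) \<Rightarrow> ereal) set" where
  "elementary_regularizers S =
     {convex_indicator (prob_measures S), convex_indicator (nonneg_measures S)} \<union>
     {\<lambda>\<mu>. ereal (r * tv_norm S \<mu>) | r. 0 \<le> r} \<union>
     {convex_indicator {\<mu>. signed_measure S \<mu> \<and> r * tv_norm S \<mu> \<le> 1} | r. 0 \<le> r}"

definition regularizer :: "'p measure \<Rightarrow> (('p set \<Rightarrow> real) \<Rightarrow> ereal) \<Rightarrow> bool" where
  "regularizer S H \<longleftrightarrow>
     (\<exists>hs. set hs \<subseteq> elementary_regularizers S \<and> H = (\<lambda>\<mu>. \<Sum>h\<leftarrow>hs. h \<mu>))"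

record ('p, 'h) objective =
  feature :: "'p \<Rightarrow> 'h"
  loss :: "'h \<Rightarrow> real"
  reg :: "('p set \<Rightarrow> real) \<Rightarrow> ereal"

definition gradient :: "('h::real_inner \<Rightarrow> real) \<Rightarrow> 'h \<Rightarrow> 'h" where
  "gradient R x = (THE D. GDERIV R x :> D)"

definition assumption_A1 ::
  "('p, 'n::finite) manifold \<Rightarrow> ('p, 'h::real_inner) objective \<Rightarrow> bool" where
  "assumption_A1 M P \<longleftrightarrow>
     continuous_map (mtop M) euclidean (feature P) \<and>
     convex_on UNIV (loss P) \<and>
     (\<forall>x. GDERIV (loss P) x :> gradient (loss P) x) \<and>
     (\<exists>L. L-lipschitz_on UNIV (gradient (loss P))) \<and>
     regularizer (manifold_borel M) (reg P)"

context
  fixes \<tau> :: "'p measure"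
    and P :: "('p, 'h::{real_inner, banach, second_countable_topology}) objective"
begin

definition G_bar :: "('p set \<Rightarrow> real) \<Rightarrow> real" where
  "G_bar \<mu> = loss P (signed_integral \<tau> \<mu> (feature P))"

definition F_bar :: "('p set \<Rightarrow> real) \<Rightarrow> ereal" where
  "F_bar \<mu> = ereal (G_bar \<mu>) + reg P \<mu>"

definition G_bar_diff :: "('p set \<Rightarrow> real) \<Rightarrow> 'p \<Rightarrow> real" where
  "G_bar_diff \<mu> \<theta> = gradient (loss P) (signed_integral \<tau> \<mu> (feature P)) \<bullet> feature P \<theta>"

abbreviation "G_fun f \<equiv> G_bar (density_measure \<tau> f)"
abbreviation "H_fun f \<equiv> reg P (density_measure \<tau> f)"
abbreviation "G_diff f \<equiv> G_bar_diff (density_measure \<tau> f)"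

definition F_fun :: "('p \<Rightarrow> real) \<Rightarrow> ereal" where
  "F_fun f = F_bar (density_measure \<tau> f)"

definition inf_F :: ereal where
  "inf_F = (INF f\<in>{f. integrable \<tau> f}. F_fun f)"


section \<open>The proximal gradient method\<close>

text \<open>For convex \<eta> the integrand is nonnegative, and the divergence may be infinite.\<close>

definition bregman :: "(real \<Rightarrow> real) \<Rightarrow> ('p \<Rightarrow> real) \<Rightarrow> ('p \<Rightarrow> real) \<Rightarrow> ereal" where
  "bregman \<eta> f g =
     enn2ereal (\<integral>\<^sup>+\<theta>. ennreal (\<eta> (f \<theta>) - \<eta> (g \<theta>) - deriv \<eta> (g \<theta>) * (f \<theta> - g \<theta>)) \<partial>\<tau>)"

definition prox_objective ::
  "(real \<Rightarrow> real) \<Rightarrow> real \<Rightarrow> ('p \<Rightarrow> real) \<Rightarrow> ('p \<Rightarrow> real) \<Rightarrow> ereal" where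
  "prox_objective \<eta> s g f =
     ereal (G_fun g + (\<integral>\<theta>. G_diff g \<theta> * (f \<theta> - g \<theta>) \<partial>\<tau>)) + H_fun f +
     ereal (1 / s) * bregman \<eta> f g"

text \<open>Elements of the space of integrable functions are given by representatives.\<close>

definition PGM :: "(real \<Rightarrow> real) \<Rightarrow> real \<Rightarrow> (nat \<Rightarrow> 'p \<Rightarrow> real) \<Rightarrow> bool" where
  "PGM \<eta> s f \<longleftrightarrow>
     integrable \<tau> (f 0) \<and> H_fun (f 0) < \<infinity> \<and>
     (\<forall>k. is_arg_min (prox_objective \<eta> s (f k)) (integrable \<tau>) (f (Suc k)))"

end

definition eta2 :: "real \<Rightarrow> real" where
  "eta2 u = u\<^sup>2 / 2"


section \<open>The four settings\<close>

datatype setting = Setting_I | Setting_I_star | Setting_II | Setting_II_star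

primrec rate :: "setting \<Rightarrow> nat" where
  "rate Setting_I = 1"
| "rate Setting_I_star = 2"
| "rate Setting_II = 2"
| "rate Setting_II_star = 4"

definition in_setting ::
  "setting \<Rightarrow> ('p, 'n::finite) manifold \<Rightarrow> 'p measure \<Rightarrow>
   ('p, 'h::{real_inner, banach, second_countable_topology}) objective \<Rightarrow> bool" where
  "in_setting T M \<tau> P \<longleftrightarrow>
     (if T \<in> {Setting_I, Setting_I_star} then Lipschitz_map M (feature P)
      else Lipschitz_derivative M (feature P)) \<and>
     (\<exists>\<mu>. signed_measure \<tau> \<mu> \<and> F_bar \<tau> P \<mu> = inf_F \<tau> P \<and>
        (T \<in> {Setting_I_star, Setting_II_star} \<longrightarrow> (\<forall>\<theta>\<in>topspace (mtop M). G_bar_diff \<tau> P \<mu> \<theta> = 0)))"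

end

theory Submission
  imports Defs
begin

text \<open>
  On the flat torus take the one-dimensional feature \<open>\<Phi> = V e\<close> with
  \<open>V x = (\<Sum>i. \<bar>cos (\<pi> x\<^sub>i)\<bar> ^ r)\<close>, the loss \<open>t ^ p / p\<close> of the coordinate along \<open>e\<close>, and the constraint to
  probability measures; then \<open>q = p r\<close>, and the Dirac mass at the unique zero of \<open>V\<close> is optimal.
  As every gradient is a nonnegative multiple of \<open>V\<close>, the iterates stay in the one-parameter family
  \<open>max 0 (l - A V)\<close>, where \<open>l\<close> normalises the mass and \<open>A\<close> grows by \<open>s m ^ (p - 1)\<close> in a step,
  \<open>m\<close> being the current mean of \<open>V\<close>. The sublevel sets of \<open>V\<close> have volume of order \<open>\<delta> powr (d / r)\<close>,
  so \<open>m\<close> is of order \<open>A powr - (r / (d + r))\<close>. Hence \<open>A\<close> grows at most like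
  \<open>k powr ((d + r) / (d + p r))\<close>, and \<open>m ^ p\<close> decays no faster than \<open>k powr - (q / (d + q))\<close>.
\<close>

section \<open>The flat torus\<close>

text \<open>A density approaches the Dirac mass only by concentrating, and this is expensive: a mean
  of order \<open>m\<close> requires mass of order one on a set of volume of order
  \<open>m powr (d / r)\<close>, while the density has height of order \<open>A * m\<close> there.
  This forces the slope \<open>A\<close> to be of order \<open>m powr - (1 + d / r)\<close>. The
  loss supplies slope at the rate \<open>s * m ^ (p - 1)\<close> per step, which is constant for
  \<open>p = 1\<close> and fades for \<open>p = 2\<close>; the balance fixes the exponent. The
  number \<open>p\<close> decides whether the differential vanishes at the optimum, \<open>r\<close>
  decides how regular the feature is, so the four settings are the four pairs \<open>(p, r)\<close>.
  Estimates of \<open>m\<close> by \<open>A\<close> from both sides enter: the upper one limits the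
  growth of \<open>A\<close> and identifies the infimum, the lower one converts the bound on
  \<open>A\<close> into a bound on the objective. The step-size affects constants only, since one
  step changes \<open>A\<close> by at most \<open>s * B ^ (p - 1)\<close>. As iterates are
  representatives modulo null sets, each explicit step has to be shown to be the minimiser up to
  null sets.\<close>

lemma Ck_on_cong:
  assumes "open S" "\<And>x. x \<in> S \<Longrightarrow> f x = g x"
  shows "Ck_on k f S = Ck_on k g S"
  using assms(2)
proof (induction k arbitrary: f g)
  case 0
  then show ?case by (simp cong: continuous_on_cong)
next
  case (Suc k)
  \<comment> \<open>\<open>frechet_derivative\<close> is a choice among the possible derivatives;
    since the two predicates agree for every \<open>D\<close>, the chosen derivatives are
    equal.\<close>
  have der: "(f has_derivative D) (at x) \<longleftrightarrow> (g has_derivative D) (at x)" if "x \<in> S" for x D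
    using has_derivative_transform_within_open[OF _ \<open>open S\<close> that] Suc.prems by metis
  then have "f differentiable at x \<longleftrightarrow> g differentiable at x" if "x \<in> S" for x
    using that by (auto simp: differentiable_def)
  moreover have "frechet_derivative f (at x) = frechet_derivative g (at x)" if "x \<in> S" for x
    unfolding frechet_derivative_def using der[OF that] by simp
  ultimately show ?case
    using Suc.IH[of "\<lambda>x. frechet_derivative f (at x) v" "\<lambda>x. frechet_derivative g (at x) v" for v]
    by simp
qed

lemma smooth_on_const: "smooth_on (\<lambda>_. c) S"
proof -
  have "Ck_on k (\<lambda>_. c) S" for k
    by (induction k arbitrary: c) (auto simp: frechet_derivative_const)
  then show ?thesis by (simp add: smooth_on_def)
qed

text \<open>The vector \<open>z\<close> may depend on the point: the overlap of two charts can fall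
  into several components, with a different integer vector on each.\<close>

lemma locally_translation_has_derivative:
  assumes "open S" "x \<in> S" "\<And>y. y \<in> S \<Longrightarrow> \<exists>z. \<forall>\<^sub>F y' in nhds y. f y' = y' + z"
  shows "(f has_derivative (\<lambda>v. v)) (at x)"
proof -
  obtain z where z: "\<forall>\<^sub>F y in nhds x. f y = y + z" using assms(2,3) by blast
  then obtain U where U: "open U" "x \<in> U" "\<And>y. y \<in> U \<Longrightarrow> f y = y + z"
    by (auto simp: eventually_nhds)
  have "((\<lambda>y. y + z) has_derivative (\<lambda>v. v)) (at x)"
    by (auto intro!: derivative_eq_intros)
  then show ?thesis
    by (rule has_derivative_transform_within_open[OF _ U(1,2)]) (simp add: U)
qed

lemma locally_translation_smooth_on:
  assumes "open S" "\<And>y. y \<in> S \<Longrightarrow> \<exists>z. \<forall>\<^sub>F y' in nhds y. f y' = y' + z"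
  shows "smooth_on f S"
  unfolding smooth_on_def
proof
  fix k
  note d = locally_translation_has_derivative[OF assms(1) _ assms(2)]
  show "Ck_on k f S"
  proof (cases k)
    case 0
    have "continuous_on S f"
      using d has_derivative_continuous continuous_at_imp_continuous_on by blast
    then show ?thesis using 0 by simp
  next
    case (Suc j)
    have "Ck_on j (\<lambda>x. frechet_derivative f (at x) v) S" for v
    proof (subst Ck_on_cong[OF assms(1)])
      show "frechet_derivative f (at x) v = v" if "x \<in> S" for x
        using frechet_derivative_at[OF d[OF that]] by metis
      show "Ck_on j (\<lambda>_. v) S" using smooth_on_const by (auto simp: smooth_on_def)
    qed
    then show ?thesis using Suc d by (auto simp: differentiable_def)
  qed
qed

section \<open>The torus as a quotient topology on the half-open cell\<close>

definition frac_vec :: "real^'n \<Rightarrow> real^'n" where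
  "frac_vec x = (\<chi> i. frac (x $ i))"

definition int_vec :: "int^'n \<Rightarrow> real^'n" where
  "int_vec z = (\<chi> i. of_int (z $ i))"

definition unit_cell :: "(real^'n) set" where
  "unit_cell = {x. \<forall>i. 0 \<le> x $ i \<and> x $ i < 1}"

lemma frac_vec_add [simp]: "frac_vec (x + int_vec z) = frac_vec x"
  by (simp add: frac_vec_def int_vec_def vec_eq_iff)

lemma frac_vec_eq_iff: "frac_vec x = frac_vec y \<longleftrightarrow> (\<exists>z. x = y + int_vec z)"
proof
  assume "frac_vec x = frac_vec y"
  then have "x = y + int_vec (\<chi> i. \<lfloor>x $ i\<rfloor> - \<lfloor>y $ i\<rfloor>)"
    by (simp add: frac_vec_def int_vec_def vec_eq_iff frac_def algebra_simps)
  then show "\<exists>z. x = y + int_vec z" ..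
qed auto

lemma frac_vec_floor: "x = frac_vec x + int_vec (\<chi> i. \<lfloor>x $ i\<rfloor>)"
  by (simp add: frac_vec_def int_vec_def vec_eq_iff frac_def)

lemma frac_vec_id [simp]: "x \<in> unit_cell \<Longrightarrow> frac_vec x = x"
  by (simp add: frac_vec_def unit_cell_def vec_eq_iff frac_eq)

lemma frac_vec_in_cell [simp]: "frac_vec x \<in> unit_cell"
  by (simp add: frac_vec_def unit_cell_def frac_lt_1)

lemma range_frac_vec: "range frac_vec = unit_cell"
  by (auto simp: image_iff) (metis frac_vec_id)

text \<open>The quotient topology of \<open>frac_vec\<close>, with the cell as set of
  representatives. It glues opposite faces, so it differs from the subspace topology of the
  cell.\<close>

definition torus_topology :: "(real^'n) topology" where
  "torus_topology = topology (\<lambda>U. U \<subseteq> unit_cell \<and> open (frac_vec -` U))"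

lemma openin_torus:
  fixes U :: "(real^'n) set"
  shows "openin torus_topology U \<longleftrightarrow> U \<subseteq> unit_cell \<and> open (frac_vec -` U)"
proof -
  have "istopology (\<lambda>U :: (real^'n) set. U \<subseteq> unit_cell \<and> open (frac_vec -` U))"
    by (auto simp: istopology_def vimage_Union)
  then show ?thesis
    unfolding torus_topology_def by (simp add: topology_inverse')
qed

lemma topspace_torus [simp]: "topspace (torus_topology :: (real^'n) topology) = unit_cell"
proof -
  have "frac_vec -` unit_cell = (UNIV :: (real^'n) set)" by auto
  then have "openin torus_topology (unit_cell :: (real^'n) set)" by (simp add: openin_torus)
  then show ?thesis by (metis openin_subset openin_torus openin_topspace subset_antisym)
qed

lemma continuous_map_frac_vec: "continuous_map euclidean torus_topology frac_vec"
  by (auto simp: continuous_map_def openin_torus vimage_def)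

lemma continuous_map_torus:
  fixes f :: "real^'n \<Rightarrow> 'b::topological_space"
  assumes "continuous_on UNIV (\<lambda>x. f (frac_vec x))"
  shows "continuous_map torus_topology euclidean f"
  using assms
  by (auto simp: continuous_map_def openin_torus continuous_on_open_vimage vimage_def)

text \<open>The saturation of \<open>S\<close> is the union of its integer translates, so
  \<open>frac_vec\<close> is an open map. This makes chart domains open and charts
  continuous.\<close>

lemma open_vimage_frac_image:
  assumes "open S"
  shows "open (frac_vec -` frac_vec ` S)"
proof -
  have "frac_vec -` frac_vec ` S = (\<Union>z. (\<lambda>x. int_vec z + x) ` S)"
    by (auto simp: frac_vec_eq_iff image_iff add.commute) blast
  then show ?thesis using assms by (auto intro: open_translation)
qed

lemma openin_torus_frac_image: "open S \<Longrightarrow> openin torus_topology (frac_vec ` S)"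
  by (auto simp: openin_torus open_vimage_frac_image)

lemma compact_torus: "compact_space (torus_topology :: (real^'n) topology)"
proof -
  have "compactin torus_topology (frac_vec ` cbox 0 (1 :: real^'n))"
    by (rule image_compactin[OF _ continuous_map_frac_vec]) simp
  moreover have "frac_vec ` cbox 0 1 = (unit_cell :: (real^'n) set)"
  proof
    show "unit_cell \<subseteq> frac_vec ` cbox 0 (1 :: real^'n)"
    proof
      fix x :: "real^'n" assume x: "x \<in> unit_cell"
      then have "x \<in> cbox 0 1" by (auto simp: unit_cell_def mem_box_cart less_imp_le)
      then show "x \<in> frac_vec ` cbox 0 1" using x by (metis frac_vec_id image_eqI)
    qed
  qed auto
  ultimately show ?thesis by (simp add: compact_space_def)
qed

lemma connected_torus: "connected_space (torus_topology :: (real^'n) topology)"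
proof -
  have "connectedin torus_topology (range (frac_vec :: real^'n \<Rightarrow> real^'n))"
    by (rule connectedin_continuous_map_image[OF continuous_map_frac_vec])
      (simp add: convex_connected)
  then show ?thesis by (simp add: range_frac_vec flip: connectedin_topspace)
qed

lemma cis_frac: "cis (2 * pi * frac t) = cis (2 * pi * t)"
proof -
  have "cis (2 * pi * t) = cis (2 * pi * frac t + 2 * pi * of_int \<lfloor>t\<rfloor>)"
    by (simp add: frac_def algebra_simps)
  then show ?thesis by (simp add: cis_mult[symmetric] cis_multiple_2pi)
qed

lemma cis_eq_cell:
  assumes "cis (2 * pi * s) = cis (2 * pi * t)" "0 \<le> s" "s < 1" "0 \<le> t" "t < 1"
  shows "s = t"
proof -
  have "sin (2 * pi * s) = sin (2 * pi * t)" "cos (2 * pi * s) = cos (2 * pi * t)"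
    using assms(1) by (simp_all add: complex_eq_iff)
  then obtain n :: int where "2 * pi * s = 2 * pi * t + 2 * pi * n"
    using sin_cos_eq_iff by blast
  then have "pi * (2 * s) = pi * (2 * (t + n))" by (simp add: algebra_simps)
  then have "s = t + n" by simp
  moreover from this have "-1 < real_of_int n" "real_of_int n < 1" using assms by linarith+
  then have "n = 0" by linarith
  ultimately show ?thesis by simp
qed

text \<open>\<open>cis\<close> turns coordinates into points of circles, which gives a continuous
  injection into a Hausdorff space and so separates points near glued faces too.\<close>

lemma Hausdorff_torus: "Hausdorff_space (torus_topology :: (real^'n) topology)"
proof -
  define f :: "real^'n \<Rightarrow> complex^'n" where "f x = (\<chi> i. cis (2 * pi * x $ i))" for x
  have "continuous_map torus_topology euclidean f"
  proof (rule continuous_map_torus)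
    show "continuous_on UNIV (\<lambda>x. f (frac_vec x))"
      unfolding f_def frac_vec_def by (simp add: cis_frac) (intro continuous_intros)
  qed
  moreover have "inj_on f (topspace torus_topology)"
    by (auto simp: inj_on_def f_def vec_eq_iff unit_cell_def intro: cis_eq_cell)
  ultimately show ?thesis
    using Hausdorff_space_injective_preimage Hausdorff_space_euclidean by blast
qed

section \<open>Charts and the flat metric\<close>

definition unit_cube :: "real^'n \<Rightarrow> (real^'n) set" where
  "unit_cube a = {x. \<forall>i. \<bar>x $ i - a $ i\<bar> < 1/2}"

lemma open_unit_cube: "open (unit_cube a)"
proof -
  have "unit_cube a = (\<Inter>i. {x. \<bar>x $ i - a $ i\<bar> < 1/2})" by (auto simp: unit_cube_def)
  moreover have "open {x. \<bar>x $ i - a $ i\<bar> < 1/2}" for i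
    by (intro open_Collect_less continuous_intros)
  ultimately show ?thesis by (auto intro: open_INT)
qed

text \<open>Points with equal reduction differ by an integer vector, and side length 1 forces its
  entries strictly between -1 and 1.\<close>

lemma inj_on_unit_cube: "inj_on frac_vec (unit_cube a)"
proof (rule inj_onI)
  fix x y assume xy: "x \<in> unit_cube a" "y \<in> unit_cube a" "frac_vec x = frac_vec y"
  then obtain z where z: "x = y + int_vec z" by (auto simp: frac_vec_eq_iff)
  have "x $ i = y $ i" for i
  proof -
    have "x $ i = y $ i + of_int (z $ i)" using z by (simp add: int_vec_def)
    moreover have "\<bar>x $ i - a $ i\<bar> < 1/2" "\<bar>y $ i - a $ i\<bar> < 1/2"
      using xy by (auto simp: unit_cube_def)
    ultimately have "-1 < real_of_int (z $ i)" "real_of_int (z $ i) < 1" by linarith+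
    then have "z $ i = 0" by linarith
    then show ?thesis using \<open>x $ i = y $ i + of_int (z $ i)\<close> by simp
  qed
  then show "x = y" by (simp add: vec_eq_iff)
qed

definition torus_chart :: "real^'n \<Rightarrow> (real^'n, 'n) chart" where
  "torus_chart a = (frac_vec ` unit_cube a, inv_into (unit_cube a) frac_vec)"

definition torus :: "(real^'n, 'n::finite) manifold" where
  "torus = \<lparr>mtop = torus_topology, charts = range torus_chart, gram = \<lambda>_ _. mat 1\<rparr>"

lemma torus_simps [simp]:
  "mtop torus = torus_topology" "charts torus = range torus_chart" "gram torus c x = mat 1"
  by (simp_all add: torus_def)

lemma chart_frac [simp]: "x \<in> unit_cube a \<Longrightarrow> snd (torus_chart a) (frac_vec x) = x"
  by (simp add: torus_chart_def inj_on_unit_cube)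

lemma chart_domain [simp]: "fst (torus_chart a) = frac_vec ` unit_cube a"
  by (simp add: torus_chart_def)

lemma chart_image_torus [simp]: "snd (torus_chart a) ` frac_vec ` unit_cube a = unit_cube a"
  by (force simp: image_iff)

lemma chart_inv_torus:
  assumes "x \<in> unit_cube a"
  shows "inv_into (frac_vec ` unit_cube a) (snd (torus_chart a)) x = frac_vec x"
proof -
  have "inj_on (snd (torus_chart a)) (frac_vec ` unit_cube a)"
    by (auto simp: inj_on_def)
  then show ?thesis
    using assms inv_into_f_f[of "snd (torus_chart a)" "frac_vec ` unit_cube a" "frac_vec x"] by simp
qed

lemma homeomorphic_map_torus_chart:
  "homeomorphic_map (subtopology torus_topology (frac_vec ` unit_cube (a :: real^'n)))
     (top_of_set (unit_cube a)) (snd (torus_chart a))"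
proof (rule homeomorphic_maps_imp_map)
  let ?T = "subtopology torus_topology (frac_vec ` unit_cube a)"
  have "continuous_map (top_of_set (unit_cube a)) ?T frac_vec"
    by (auto simp: continuous_map_in_subtopology
        intro: continuous_map_from_subtopology continuous_map_frac_vec)
  moreover have "continuous_map ?T (top_of_set (unit_cube a)) (snd (torus_chart a))"
    unfolding continuous_map_in_subtopology
  proof
    show "continuous_map ?T euclidean (snd (torus_chart a))"
      unfolding continuous_map_def
    proof (intro conjI allI impI)
      fix U :: "(real^'n) set" assume "openin euclidean U"
      then have "open (unit_cube a \<inter> U)" by (auto intro: open_unit_cube)
      then have "openin torus_topology (frac_vec ` (unit_cube a \<inter> U))"
        by (rule openin_torus_frac_image)
      moreover have "{x \<in> topspace ?T. snd (torus_chart a) x \<in> U} = frac_vec ` (unit_cube a \<inter> U)"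
        by auto
      ultimately show "openin ?T {x \<in> topspace ?T. snd (torus_chart a) x \<in> U}"
        by (auto simp: openin_subtopology_alt image_iff)
    qed auto
  qed auto
  ultimately show "homeomorphic_maps ?T (top_of_set (unit_cube a)) (snd (torus_chart a)) frac_vec"
    unfolding homeomorphic_maps_def by auto
qed

lemma chart_overlap:
  "snd (torus_chart a) ` (frac_vec ` unit_cube a \<inter> frac_vec ` unit_cube b)
     = unit_cube a \<inter> frac_vec -` frac_vec ` unit_cube b"
proof -
  have "frac_vec ` unit_cube a \<inter> frac_vec ` unit_cube b
      = frac_vec ` (unit_cube a \<inter> frac_vec -` frac_vec ` unit_cube b)" by auto
  moreover have "snd (torus_chart a) ` frac_vec ` S = S" if "S \<subseteq> unit_cube a" for S
    using that by (force simp: image_iff)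
  ultimately show ?thesis by simp
qed

lemma open_chart_overlap: "open (unit_cube a \<inter> frac_vec -` frac_vec ` unit_cube b)"
  by (intro open_Int open_unit_cube open_vimage_frac_image)

text \<open>The integer vector that carries \<open>x\<close> into the second cube serves on a whole
  neighbourhood, since both cubes are open.\<close>

lemma chart_transition_torus:
  assumes "x \<in> unit_cube a \<inter> frac_vec -` frac_vec ` unit_cube b"
  shows "\<exists>z. \<forall>\<^sub>F y in nhds x. chart_transition (torus_chart a) (torus_chart b) y = y + z"
proof -
  from assms obtain x' where x': "x' \<in> unit_cube b" "frac_vec x' = frac_vec x"
    by (metis IntD2 imageE vimageE)
  then obtain z where z: "x' = x + int_vec z" by (auto simp: frac_vec_eq_iff)
  define U where "U = unit_cube a \<inter> (\<lambda>y. y + int_vec z) -` unit_cube b"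
  have "open U" unfolding U_def
    by (intro open_Int open_unit_cube open_vimage continuous_intros)
  moreover have "x \<in> U" using assms x' z by (auto simp: U_def)
  moreover have "chart_transition (torus_chart a) (torus_chart b) y = y + int_vec z"
    if "y \<in> U" for y
  proof -
    have "snd (torus_chart b) (frac_vec (y + int_vec z)) = y + int_vec z"
      using that by (intro chart_frac) (auto simp: U_def)
    then show ?thesis using that by (simp add: U_def chart_inv_torus)
  qed
  ultimately have "\<forall>\<^sub>F y in nhds x. chart_transition (torus_chart a) (torus_chart b) y = y + int_vec z"
    by (auto simp: eventually_nhds)
  then show ?thesis ..
qed

lemma smooth_atlas_torus: "smooth_atlas (torus :: (real^'n, 'n) manifold)"
proof -
  have "(\<Union>a. frac_vec ` unit_cube a) = (unit_cell :: (real^'n) set)"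
  proof
    show "(unit_cell :: (real^'n) set) \<subseteq> (\<Union>a. frac_vec ` unit_cube a)"
    proof
      fix x :: "real^'n" assume "x \<in> unit_cell"
      then have "x = frac_vec x" "x \<in> unit_cube x" by (auto simp: unit_cube_def)
      then show "x \<in> (\<Union>a. frac_vec ` unit_cube a)" by blast
    qed
  qed auto
  moreover have "smooth_on (chart_transition (torus_chart a) (torus_chart b))
      (unit_cube a \<inter> frac_vec -` frac_vec ` unit_cube b)" for a b :: "real^'n"
    by (rule locally_translation_smooth_on[OF open_chart_overlap chart_transition_torus])
  ultimately show ?thesis
    unfolding smooth_atlas_def
    by (simp add: image_image chart_overlap open_unit_cube homeomorphic_map_torus_chart
        openin_torus_frac_image)
qed

text \<open>Transitions have the identity as derivative, so the constant identity matrix is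
  compatible between charts.\<close>

lemma riemannian_metric_torus: "riemannian_metric (torus :: (real^'n, 'n) manifold)"
proof -
  have *: "frechet_derivative (chart_transition (torus_chart a) (torus_chart b)) (at x) = (\<lambda>v. v)"
    if "x \<in> unit_cube a \<inter> frac_vec -` frac_vec ` unit_cube b" for a b x :: "real^'n"
    using frechet_derivative_at[OF locally_translation_has_derivative[OF open_chart_overlap that
          chart_transition_torus[of _ a b]]] by (simp add: o_def)
  have "frechet_derivative (chart_transition c c') (at x) = (\<lambda>v. v)"
    if "c \<in> charts torus" "c' \<in> charts torus" "x \<in> snd c ` (fst c \<inter> fst c')"
    for c c' :: "(real^'n, 'n) chart" and x
  proof -
    obtain a b where c: "c = torus_chart a" "c' = torus_chart b" using \<open>c \<in> _\<close> \<open>c' \<in> _\<close> by auto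
    then have "x \<in> unit_cube a \<inter> frac_vec -` frac_vec ` unit_cube b"
      using that(3) chart_overlap[of a b] by simp
    then show ?thesis unfolding c by (rule *)
  qed
  moreover have "gram torus c = (\<lambda>_. mat 1)" for c :: "(real^'n, 'n) chart" by (simp add: fun_eq_iff)
  ultimately show ?thesis
    unfolding riemannian_metric_def
    by (simp add: smooth_on_const transpose_mat Let_def del: o_apply torus_simps(2))
qed

lemma compact_riemannian_manifold_torus:
  "compact_riemannian_manifold (torus :: (real^'n, 'n) manifold)"
proof -
  have "(0 :: real^'n) \<in> unit_cell" by (simp add: unit_cell_def)
  then show ?thesis
    unfolding compact_riemannian_manifold_def
    by (auto simp: Hausdorff_torus compact_torus connected_torus smooth_atlas_torus
        riemannian_metric_torus)
qed


section \<open>Curve lengths and Lipschitz maps\<close>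

text \<open>Induction on the pieces: inside one chart the coordinate distance of the endpoints is at
  most the length of the piece, by the fundamental theorem of calculus. Comparing values of
  \<open>f\<close> piece by piece replaces a lift of the whole curve.\<close>

lemma curve_length_torus_bound:
  fixes f :: "real^'n \<Rightarrow> 'h::metric_space"
  assumes L: "\<And>a b. dist (f (frac_vec a)) (f (frac_vec b)) \<le> L * dist a b" "0 \<le> L"
    and "curve_length torus x y l"
  shows "dist (f x) (f y) \<le> L * l"
  using assms(3)
proof induction
  case const
  then show ?case by simp
next
  case (piece y l c z g g')
  then obtain a where a: "c = torus_chart a" by auto
  have frac: "frac_vec (snd c w) = w" if "w \<in> fst c" for w
    using that by (auto simp: a)
  have int: "(g' has_integral (g 1 - g 0)) {0..1}"
    using piece by (intro fundamental_theorem_of_calculus) auto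
  have "norm (g 1 - g 0) = norm (integral {0..1} g')"
    using int by (simp add: integral_unique)
  also have "\<dots> \<le> integral {0..1} (\<lambda>t. norm (g' t))"
    by (intro integral_norm_bound_integral integrable_continuous_interval continuous_intros piece) auto
  also have "\<dots> = integral {0..1} (\<lambda>t. sqrt (g' t \<bullet> (gram torus c (g t) *v g' t)))"
    by (simp add: norm_eq_sqrt_inner)
  finally have len: "dist (g 0) (g 1) \<le> \<dots>" by (simp add: dist_norm norm_minus_commute)
  have "dist (f y) (f z) \<le> L * dist (g 0) (g 1)"
    using L(1)[of "g 0" "g 1"] piece frac by simp
  also have "\<dots> \<le> L * integral {0..1} (\<lambda>t. sqrt (g' t \<bullet> (gram torus c (g t) *v g' t)))"
    using len L(2) by (rule mult_left_mono)
  finally show ?case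
    using piece.IH dist_triangle[of "f x" "f z" "f y"] by (simp add: distrib_left)
qed

text \<open>Guards against the infimum of an empty set in \<open>geodesic_dist\<close>. Coordinates
  in the cell differ by less than 1, so the cube around the midpoint contains the straight segment
  between the points.\<close>

lemma curve_length_torus_exists:
  assumes "x \<in> unit_cell" "y \<in> unit_cell"
  shows "\<exists>l. curve_length torus x y l"
proof -
  define a where "a = (1/2) *\<^sub>R (x + y)"
  have "\<bar>x $ i - y $ i\<bar> < 1" for i
    using assms by (auto simp: unit_cell_def abs_less_iff) (smt (verit))+
  then have xy: "x \<in> unit_cube a" "y \<in> unit_cube a"
    by (auto simp: unit_cube_def a_def abs_less_iff field_simps)
  then have dom: "x \<in> fst (torus_chart a)" "y \<in> fst (torus_chart a)"
    using assms by (auto simp: image_iff) (metis frac_vec_id)+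
  have chart: "snd (torus_chart a) x = x" "snd (torus_chart a) y = y"
    using chart_frac[OF xy(1)] chart_frac[OF xy(2)] assms by auto
  have "\<bar>(x + t *\<^sub>R (y - x)) $ i - a $ i\<bar> < 1/2" if "t \<in> {0..1}" for t i
  proof -
    have "(x + t *\<^sub>R (y - x)) $ i - a $ i = (1/2 - t) * (x $ i - y $ i)"
      by (simp add: a_def algebra_simps)
    also have "\<bar>\<dots>\<bar> \<le> 1/2 * \<bar>x $ i - y $ i\<bar>"
      unfolding abs_mult using that by (intro mult_right_mono abs_leI) auto
    also have "\<dots> < 1/2" using \<open>\<bar>x $ i - y $ i\<bar> < 1\<close> by simp
    finally show ?thesis .
  qed
  then have "(\<lambda>t. x + t *\<^sub>R (y - x)) ` {0..1} \<subseteq> chart_image (torus_chart a)"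
    unfolding chart_domain chart_image_torus by (auto simp: unit_cube_def)
  moreover have "((\<lambda>t. x + t *\<^sub>R (y - x)) has_vector_derivative (y - x)) (at t within {0..1})" for t
    by (auto intro!: derivative_eq_intros)
  moreover have "curve_length torus x x 0" using assms by (intro curve_length.const) simp
  ultimately show ?thesis
    using curve_length.piece[of torus x x 0 "torus_chart a" y "\<lambda>t. x + t *\<^sub>R (y - x)" "\<lambda>_. y - x"]
      dom chart by auto
qed

lemma Lipschitz_map_torus:
  fixes f :: "real^'n \<Rightarrow> 'h::metric_space"
  assumes "\<And>a b. dist (f (frac_vec a)) (f (frac_vec b)) \<le> L * dist a b" "0 \<le> L"
  shows "Lipschitz_map torus f"
  unfolding Lipschitz_map_def
proof (intro exI ballI)
  fix x y :: "real^'n" assume "x \<in> topspace (mtop torus)" "y \<in> topspace (mtop torus)"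
  then have ne: "{l. curve_length torus x y l} \<noteq> {}"
    using curve_length_torus_exists[of x y] by auto
  have b: "dist (f x) (f y) \<le> L * l" if "curve_length torus x y l" for l
    using curve_length_torus_bound[OF assms that] .
  show "dist (f x) (f y) \<le> L * geodesic_dist torus x y"
  \<comment> \<open>Division by \<open>L\<close> brings the bound under the infimum, which requires
    \<open>L\<close> to be nonzero.\<close>
  proof (cases "L = 0")
    case True
    then show ?thesis using ne b by auto
  next
    case False
    then have "dist (f x) (f y) / L \<le> l" if "curve_length torus x y l" for l
      using b[OF that] assms(2) by (simp add: field_simps)
    then have "dist (f x) (f y) / L \<le> geodesic_dist torus x y"
      unfolding geodesic_dist_def using ne by (intro cInf_greatest) auto
    then show ?thesis using False assms(2) by (simp add: field_simps)
  qed
qed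

section \<open>The volume measure\<close>

text \<open>On the cell \<open>frac_vec\<close> is the identity; the push-forward only changes the
  sigma-algebra to that of the quotient topology.\<close>

definition torus_measure :: "(real^'n) measure" where
  "torus_measure = distr (restrict_space lborel unit_cell) (manifold_borel torus) frac_vec"

lemma unit_cell_borel [measurable]: "unit_cell \<in> sets borel"
proof -
  have "unit_cell = (\<Inter>i. {x :: real^'n. 0 \<le> x $ i \<and> x $ i < 1})" by (auto simp: unit_cell_def)
  also have "\<dots> \<in> sets borel" by measurable
  finally show ?thesis .
qed

lemma space_manifold_borel_torus [simp]: "space (manifold_borel torus) = unit_cell"
  by (simp add: manifold_borel_def space_measure_of_conv)

lemma sets_manifold_borel_torus:
  "sets (manifold_borel (torus :: (real^'n, 'n) manifold)) = sigma_sets unit_cell {U. openin torus_topology U}"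
proof -
  have "{U. openin torus_topology U} \<subseteq> Pow (unit_cell :: (real^'n) set)"
    by (auto simp: openin_torus)
  then show ?thesis unfolding manifold_borel_def torus_simps topspace_torus by (rule sets_measure_of)
qed

lemma measurable_frac_vec [measurable]: "frac_vec \<in> measurable borel (manifold_borel torus)"
  unfolding manifold_borel_def
proof (rule measurable_measure_of)
  show "{U. openin (mtop torus) U} \<subseteq> Pow (topspace (mtop torus))"
    using openin_subset by blast
qed (auto simp: openin_torus)

lemma measurable_torus:
  fixes f :: "real^'n \<Rightarrow> 'b::topological_space"
  assumes "continuous_map torus_topology euclidean f"
  shows "f \<in> borel_measurable (manifold_borel torus)"
proof (rule borel_measurableI)
  fix S :: "'b set" assume "open S"
  then have "openin torus_topology {x \<in> unit_cell. f x \<in> S}"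
    using assms by (auto simp: continuous_map_def)
  moreover have "f -` S \<inter> space (manifold_borel torus) = {x \<in> unit_cell. f x \<in> S}" by auto
  ultimately show "f -` S \<inter> space (manifold_borel torus) \<in> sets (manifold_borel torus)"
    by (simp add: sets_manifold_borel_torus sigma_sets.Basic)
qed

lemma space_torus_measure [simp]: "space torus_measure = unit_cell"
  by (simp add: torus_measure_def)

lemma sets_torus_measure [measurable_cong]: "sets torus_measure = sets (manifold_borel torus)"
  by (simp add: torus_measure_def)

lemma borel_of_torus:
  assumes "A \<in> sets (manifold_borel torus)"
  shows "A \<in> sets borel"
proof -
  have "A \<subseteq> unit_cell" using sets.sets_into_space[OF assms] by simp
  then have "A = frac_vec -` A \<inter> unit_cell" by auto
  moreover have "frac_vec -` A \<in> sets borel"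
    using measurable_sets[OF measurable_frac_vec assms] by simp
  ultimately show ?thesis by (metis sets.Int unit_cell_borel)
qed

lemma emeasure_torus:
  assumes "A \<in> sets (manifold_borel torus)"
  shows "emeasure torus_measure A = emeasure lborel A"
proof -
  have A: "A \<subseteq> unit_cell" using sets.sets_into_space[OF assms] by simp
  then have eq: "A = frac_vec -` A \<inter> unit_cell" by auto
  have "frac_vec \<in> measurable (restrict_space lborel unit_cell) (manifold_borel torus)"
    by (rule measurable_restrict_space1) simp
  then have "emeasure torus_measure A =
      emeasure (restrict_space lborel unit_cell) (frac_vec -` A \<inter> unit_cell)"
    unfolding torus_measure_def using assms by (subst emeasure_distr) (auto simp: space_restrict_space)
  also have "\<dots> = emeasure lborel A"
    using A by (subst emeasure_restrict_space) (auto simp flip: eq)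
  finally show ?thesis .
qed

lemma translate_borel:
  fixes B :: "(real^'n) set"
  assumes "B \<in> sets borel"
  shows "(\<lambda>x. x + c) ` B \<in> sets borel"
    and "emeasure lborel ((\<lambda>x. x + c) ` B) = emeasure lborel B"
proof -
  have im: "(\<lambda>x. x + c) ` B = (\<lambda>x. - c + x) -` B"
  proof
    show "(\<lambda>x. - c + x) -` B \<subseteq> (\<lambda>x. x + c) ` B"
      by (auto intro!: image_eqI[where x = "- c + _"])
  qed auto
  have m: "(\<lambda>x. - c + x) \<in> measurable borel borel" by simp
  show "(\<lambda>x. x + c) ` B \<in> sets borel"
    unfolding im using measurable_sets[OF m assms] unfolding space_borel Int_UNIV_right .
  have "emeasure lborel B = emeasure (distr lborel borel ((+) (- c))) B"
    by (simp add: lborel_distr_plus)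
  also have "\<dots> = emeasure lborel ((\<lambda>x. x + c) ` B)"
    unfolding im using assms by (subst emeasure_distr) auto
  finally show "emeasure lborel ((\<lambda>x. x + c) ` B) = emeasure lborel B" by simp
qed

text \<open>Cut \<open>B\<close> along the integer translates of the cell: on each piece
  \<open>frac_vec\<close> is a translation, and injectivity keeps the shifted pieces disjoint. This
  handles charts whose cube crosses a face of the cell.\<close>

lemma emeasure_frac_image:
  fixes B :: "(real^'n) set"
  assumes B: "B \<in> sets borel" "inj_on frac_vec B"
  shows "emeasure lborel (frac_vec ` B) = emeasure lborel B"
    and "frac_vec ` B \<in> sets borel"
proof -
  define P where "P z = B \<inter> (\<lambda>x. x + int_vec z) ` unit_cell" for z :: "int^'n"
  define Q where "Q z = (\<lambda>x. x + (- int_vec z)) ` P z" for z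
  have Pm: "P z \<in> sets borel" for z
    unfolding P_def by (intro sets.Int B translate_borel(1) unit_cell_borel)
  have Qm: "Q z \<in> sets borel" for z
    unfolding Q_def by (intro translate_borel(1) Pm)
  have fracP: "frac_vec (x :: real^'n) = x + (- int_vec z)" if x: "x \<in> P z" for x z
  proof -
    obtain y where y: "y \<in> unit_cell" "x = y + int_vec z" using x unfolding P_def by blast
    then have "frac_vec x = y" by simp
    then show ?thesis using y by simp
  qed
  have BP: "B = (\<Union>z. P z)"
    using frac_vec_floor frac_vec_in_cell unfolding P_def by blast
  have QP: "Q z = frac_vec ` P z" for z
    unfolding Q_def by (intro image_cong) (simp_all add: fracP)
  then have fB: "frac_vec ` B = (\<Union>z. Q z)" by (subst BP) auto
  show "frac_vec ` B \<in> sets borel"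
    unfolding fB by (intro sets.countable_UN' countableI_type) (auto intro: Qm)
  have "disjoint_family P"
    unfolding disjoint_family_on_def
  proof (intro ballI impI)
    fix z w :: "int^'n" assume "z \<noteq> w"
    show "P z \<inter> P w = {}"
    proof (rule ccontr)
      assume "P z \<inter> P w \<noteq> {}"
      then obtain x where "x \<in> P z" "x \<in> P w" by auto
      then have "int_vec z = int_vec w" using fracP[of x z] fracP[of x w] by simp
      then show False using \<open>z \<noteq> w\<close> by (simp add: int_vec_def vec_eq_iff)
    qed
  qed
  moreover have "disjoint_family Q"
    unfolding disjoint_family_on_def QP
  proof (intro ballI impI)
    fix z w :: "int^'n" assume "z \<noteq> w"
    then have "P z \<inter> P w = {}" using \<open>disjoint_family P\<close> by (auto simp: disjoint_family_on_def)
    moreover have "P z \<subseteq> B" "P w \<subseteq> B" by (auto simp: P_def)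
    ultimately show "frac_vec ` P z \<inter> frac_vec ` P w = {}"
      using B(2) by (metis image_empty inj_on_image_Int)
  qed
  moreover have "emeasure lborel (Q z) = emeasure lborel (P z)" for z
    unfolding Q_def by (rule translate_borel(2)[OF Pm])
  ultimately show "emeasure lborel (frac_vec ` B) = emeasure lborel B"
    unfolding fB by (subst BP) (simp add: emeasure_UN_countable countableI_type Pm Qm)
qed

text \<open>The Gram determinant is 1, so a subset of a chart domain must have the Lebesgue measure
  of its coordinate image.\<close>

lemma volume_measure_torus: "volume_measure torus (torus_measure :: (real^'n) measure)"
  unfolding volume_measure_def
proof (intro conjI ballI impI)
  fix c :: "(real^'n, 'n) chart" and A
  assume "c \<in> charts torus" and A: "A \<in> sets torus_measure" "A \<subseteq> fst c"
  then obtain a where a: "c = torus_chart a" by auto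
  define B where "B = unit_cube a \<inter> frac_vec -` A"
  have "frac_vec -` A \<in> sets borel"
    using measurable_sets[OF measurable_frac_vec, of A] A by (simp add: sets_torus_measure)
  then have B: "B \<in> sets borel" unfolding B_def by (simp add: borel_open open_unit_cube sets.Int)
  have "inj_on frac_vec B" by (rule inj_on_subset[OF inj_on_unit_cube]) (auto simp: B_def)
  moreover have AB: "A = frac_vec ` B" using A(2) by (auto simp: B_def a)
  moreover have "snd c ` A = B" unfolding AB by (force simp: a B_def image_iff)
  ultimately show "emeasure torus_measure A =
      (\<integral>\<^sup>+x. ennreal (sqrt (det (gram torus c x))) * indicator (snd c ` A) x \<partial>lborel)"
    using emeasure_torus[of A] A B by (simp add: sets_torus_measure emeasure_frac_image)
qed (simp_all add: sets_torus_measure)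

lemma emeasure_lborel_cart:
  fixes a b :: "real^'n"
  assumes "\<And>i. a $ i \<le> b $ i"
  shows "emeasure lborel (cbox a b) = ennreal (\<Prod>i\<in>UNIV. b $ i - a $ i)"
    and "emeasure lborel (box a b) = ennreal (\<Prod>i\<in>UNIV. b $ i - a $ i)"
proof -
  have "cbox a b \<noteq> {}" using assms by (simp add: interval_ne_empty_cart)
  then have "measure lborel (cbox a b) = (\<Prod>i\<in>UNIV. b $ i - a $ i)"
    by (rule content_cbox_cart)
  moreover have "emeasure lborel (cbox a b) = ennreal (measure lborel (cbox a b))"
    by (rule emeasure_eq_ennreal_measure) (use emeasure_lborel_cbox_finite[of a b] in \<open>simp add: top.not_eq_extremum\<close>)
  ultimately show "emeasure lborel (cbox a b) = ennreal (\<Prod>i\<in>UNIV. b $ i - a $ i)" by simp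
  then show "emeasure lborel (box a b) = ennreal (\<Prod>i\<in>UNIV. b $ i - a $ i)"
    by (simp only: emeasure_lborel_box_eq emeasure_lborel_cbox_eq)
qed

lemma emeasure_unit_cell: "emeasure lborel (unit_cell :: (real^'n) set) = 1"
proof (rule antisym)
  have "emeasure lborel (unit_cell :: (real^'n) set) \<le> emeasure lborel (cbox 0 (1 :: real^'n))"
    by (rule emeasure_mono) (auto simp: unit_cell_def mem_box_cart less_imp_le)
  then show "emeasure lborel (unit_cell :: (real^'n) set) \<le> 1" by (simp add: emeasure_lborel_cart)
  have "emeasure lborel (box 0 (1 :: real^'n)) \<le> emeasure lborel (unit_cell :: (real^'n) set)"
    by (rule emeasure_mono) (auto simp: unit_cell_def mem_box_cart less_imp_le)
  then show "1 \<le> emeasure lborel (unit_cell :: (real^'n) set)" by (simp add: emeasure_lborel_cart)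
qed

lemma emeasure_torus_space:
  "emeasure torus_measure (space (torus_measure :: (real^'n) measure)) = 1"
proof -
  have "unit_cell \<in> sets (manifold_borel (torus :: (real^'n, 'n) manifold))"
    by (metis sets.top space_manifold_borel_torus)
  then show ?thesis by (simp add: emeasure_torus emeasure_unit_cell)
qed

lemma normalized_volume_torus: "normalized_volume torus (torus_measure :: (real^'n) measure)"
  unfolding normalized_volume_def
proof (intro exI conjI)
  show "volume_measure torus (torus_measure :: (real^'n) measure)" by (rule volume_measure_torus)
  show "torus_measure = scale_measure (1 / emeasure torus_measure (space torus_measure))
      (torus_measure :: (real^'n) measure)"
    unfolding emeasure_torus_space by simp
qed

section \<open>Proximal steps for a one-dimensional feature\<close>

text \<open>For a nonnegative set function the supremum over subsets of \<open>A\<close> is attained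
  at \<open>A\<close> itself, for its negative at the empty set.\<close>

lemma positive_part_of_measure:
  assumes "finite_measure N" "sets N = sets S" "\<And>A. A \<in> sets S \<Longrightarrow> \<mu> A = measure N A"
  shows "positive_part S \<mu> = N" and "negative_part S \<mu> = null_measure S"
proof -
  interpret finite_measure N by fact
  have sp: "space N = space S" using assms(2) by (rule sets_eq_imp_space_eq)
  have "ennreal (SUP B\<in>{B\<in>sets S. B \<subseteq> A}. \<mu> B) = emeasure N A" if "A \<in> sets S" for A
  proof -
    have "(SUP B\<in>{B\<in>sets S. B \<subseteq> A}. \<mu> B) = measure N A"
      using that assms
      by (intro cSup_eq_maximum) (auto intro!: finite_measure_mono simp: image_iff)
    then show ?thesis by (simp add: emeasure_eq_measure)
  qed
  then have "positive_part S \<mu> = measure_of (space S) (sets S) (emeasure N)"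
    unfolding positive_part_def
    by (intro measure_of_eq) (auto simp: sets.space_closed sets.sigma_sets_eq)
  also have "\<dots> = N" using measure_of_of_measure[of N] by (simp add: sp assms(2))
  finally show "positive_part S \<mu> = N" .
  have "ennreal (SUP B\<in>{B\<in>sets S. B \<subseteq> A}. - \<mu> B) = 0" if "A \<in> sets S" for A
  proof -
    have "(SUP B\<in>{B\<in>sets S. B \<subseteq> A}. - \<mu> B) = 0"
      using that assms
      by (intro cSup_eq_maximum) (auto simp: image_iff intro!: bexI[of _ "{}"])
    then show ?thesis by simp
  qed
  then show "negative_part S \<mu> = null_measure S"
    unfolding positive_part_def null_measure_def
    by (intro measure_of_eq) (auto simp: sets.space_closed sets.sigma_sets_eq)
qed

lemma signed_integral_of_measure:
  assumes "finite_measure N" "sets N = sets S" "\<And>A. A \<in> sets S \<Longrightarrow> \<mu> A = measure N A"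
  shows "signed_integral S \<mu> \<Phi> = integral\<^sup>L N \<Phi>"
proof -
  have "positive_part S \<mu> = N" by (rule positive_part_of_measure(1)) fact+
  moreover have "negative_part S \<mu> = null_measure S"
    by (rule positive_part_of_measure(2)[where N = N]) fact+
  ultimately show ?thesis by (simp add: signed_integral_def)
qed

lemma signed_measure_of_measure:
  assumes "finite_measure N" "sets N = sets S" "\<And>A. A \<in> sets S \<Longrightarrow> \<mu> A = measure N A"
  shows "signed_measure S \<mu>"
proof -
  interpret finite_measure N by fact
  have "(\<lambda>i::nat. \<mu> (A i)) sums \<mu> (\<Union>i. A i)" if "range A \<subseteq> sets S" "disjoint_family A" for A
  proof -
    have "\<mu> (A i) = measure N (A i)" for i using that assms by auto
    moreover have "\<mu> (\<Union>i. A i) = measure N (\<Union>i. A i)"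
      using that assms by (metis sets.countable_nat_UN)
    ultimately show ?thesis using finite_measure_UNION[of A] that assms by simp
  qed
  then show ?thesis using assms by (auto simp: signed_measure_def)
qed

section \<open>The loss along one direction\<close>

definition unit_ell2 :: ell2 where "unit_ell2 = finite_ell2 [1]"

lemma inner_unit_ell2 [simp]: "unit_ell2 \<bullet> unit_ell2 = 1"
proof -
  have c: "coord unit_ell2 n = (if n = 0 then 1 else 0)" for n
    by (simp add: unit_ell2_def finite_ell2.rep_eq)
  have "unit_ell2 \<bullet> unit_ell2 = (\<Sum>n. (coord unit_ell2 n)\<^sup>2)"
    by (simp add: norm_ell2_square flip: power2_norm_eq_inner)
  also have "\<dots> = (\<Sum>n\<in>{0}. (coord unit_ell2 n)\<^sup>2)"
    by (rule suminf_finite) (auto simp: c)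
  finally show ?thesis by (simp add: c)
qed

lemma norm_unit_ell2 [simp]: "norm unit_ell2 = 1"
  by (simp add: norm_eq_sqrt_inner)

text \<open>Linear for \<open>p = 1\<close>, so the gradient is nonzero everywhere, and quadratic
  for \<open>p = 2\<close>, so the gradient vanishes where the coordinate does.\<close>

definition ray_loss :: "nat \<Rightarrow> ell2 \<Rightarrow> real" where
  "ray_loss p x = (x \<bullet> unit_ell2) ^ p / real p"

text \<open>For \<open>p = 1\<close> the exponent \<open>p - 1\<close> is 0 and the power equals 1,
  also at coordinate 0.\<close>

lemma GDERIV_ray_loss:
  assumes "0 < p"
  shows "GDERIV (ray_loss p) x :> (x \<bullet> unit_ell2) ^ (p - 1) *\<^sub>R unit_ell2"
  unfolding gderiv_def ray_loss_def using assms
  by (auto intro!: derivative_eq_intros simp: field_simps)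

lemma gradient_ray_loss:
  assumes "0 < p"
  shows "gradient (ray_loss p) x = (x \<bullet> unit_ell2) ^ (p - 1) *\<^sub>R unit_ell2"
  unfolding gradient_def
proof (rule the_equality)
  show "GDERIV (ray_loss p) x :> (x \<bullet> unit_ell2) ^ (p - 1) *\<^sub>R unit_ell2"
    by (rule GDERIV_ray_loss[OF assms])
  fix D assume "GDERIV (ray_loss p) x :> D"
  then have "(\<lambda>h. h \<bullet> D) = (\<lambda>h. h \<bullet> ((x \<bullet> unit_ell2) ^ (p - 1) *\<^sub>R unit_ell2))"
    using GDERIV_ray_loss[OF assms] unfolding gderiv_def by (rule has_derivative_unique)
  then show "D = (x \<bullet> unit_ell2) ^ (p - 1) *\<^sub>R unit_ell2"
    by (metis vector_eq_ldot)
qed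

lemma Lipschitz_gradient_ray_loss:
  assumes "p \<in> {1, 2}"
  shows "1-lipschitz_on UNIV (gradient (ray_loss p))"
proof (rule lipschitz_onI)
  fix x y
  have "\<bar>x \<bullet> unit_ell2 - y \<bullet> unit_ell2\<bar> \<le> norm (x - y)"
    using Cauchy_Schwarz_ineq2[of "x - y" unit_ell2] by (simp add: inner_diff_left)
  then show "dist (gradient (ray_loss p) x) (gradient (ray_loss p) y) \<le> 1 * dist x y"
    using assms by (auto simp: gradient_ray_loss dist_norm simp flip: scaleR_left_diff_distrib)
qed simp

lemma convex_ray_loss:
  assumes "p \<in> {1, 2}"
  shows "convex_on UNIV (ray_loss p)"
proof (rule convex_onI)
  fix t :: real and x y :: ell2
  assume t: "0 < t" "t < 1"
  define a b where "a = x \<bullet> unit_ell2" and "b = y \<bullet> unit_ell2"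
  have "((1 - t) * a + t * b) ^ p \<le> (1 - t) * a ^ p + t * b ^ p"
  proof (cases "p = 1")
    case False
    \<comment> \<open>The convexity gap of the square is exactly this term.\<close>
    have "0 \<le> t * (1 - t) * (a - b)\<^sup>2" using t by simp
    also have "\<dots> = (1 - t) * a\<^sup>2 + t * b\<^sup>2 - ((1 - t) * a + t * b)\<^sup>2"
      by (simp add: power2_eq_square algebra_simps)
    finally show ?thesis using False assms by simp
  qed simp
  then have "((1 - t) * a + t * b) ^ p / p \<le> ((1 - t) * a ^ p + t * b ^ p) / p"
    by (rule divide_right_mono) simp
  then show "ray_loss p ((1 - t) *\<^sub>R x + t *\<^sub>R y) \<le> (1 - t) * ray_loss p x + t * ray_loss p y"
    by (simp add: ray_loss_def inner_add_left a_def b_def add_divide_distrib)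
qed simp

section \<open>The objective and its proximal functional for a scalar potential\<close>

locale potential = finite_measure \<tau> for \<tau> :: "'p measure" +
  fixes S :: "'p measure" and V :: "'p \<Rightarrow> real" and B :: real and p :: nat
  assumes mass: "measure \<tau> (space \<tau>) = 1"
    and sets_S: "sets S = sets \<tau>"
    and V_measurable [measurable]: "V \<in> borel_measurable \<tau>"
    and V_nonneg: "\<And>\<theta>. \<theta> \<in> space \<tau> \<Longrightarrow> 0 \<le> V \<theta>"
    and V_le: "\<And>\<theta>. \<theta> \<in> space \<tau> \<Longrightarrow> V \<theta> \<le> B"
    and p: "p \<in> {1, 2}"
begin

definition obj :: "('p, ell2) objective" where
  "obj = \<lparr>feature = \<lambda>\<theta>. V \<theta> *\<^sub>R unit_ell2, loss = ray_loss p,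
     reg = convex_indicator (prob_measures S)\<rparr>"

lemma obj_simps [simp]:
  "feature obj \<theta> = V \<theta> *\<^sub>R unit_ell2" "loss obj = ray_loss p"
  "reg obj = convex_indicator (prob_measures S)"
  by (simp_all add: obj_def)

lemma p_pos: "0 < p" using p by auto

definition prob_density :: "('p \<Rightarrow> real) \<Rightarrow> bool" where
  "prob_density f \<longleftrightarrow> integrable \<tau> f \<and> (AE \<theta> in \<tau>. 0 \<le> f \<theta>) \<and> integral\<^sup>L \<tau> f = 1"

definition mean :: "('p \<Rightarrow> real) \<Rightarrow> real" where
  "mean f = (\<integral>\<theta>. V \<theta> * f \<theta> \<partial>\<tau>)"

lemma abs_V_le: "\<theta> \<in> space \<tau> \<Longrightarrow> \<bar>V \<theta>\<bar> \<le> B"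
  using V_nonneg V_le by fastforce

lemma integrable_V_mult [intro]:
  assumes "integrable \<tau> f"
  shows "integrable \<tau> (\<lambda>\<theta>. V \<theta> * f \<theta>)"
proof (rule Bochner_Integration.integrable_bound)
  show "integrable \<tau> (\<lambda>\<theta>. B * f \<theta>)" using assms by simp
  show "AE \<theta> in \<tau>. norm (V \<theta> * f \<theta>) \<le> norm (B * f \<theta>)"
    using mult_right_mono[OF order_trans[OF abs_V_le abs_ge_self] abs_ge_zero]
    by (auto intro!: AE_I2 simp: abs_mult)
qed (use assms in auto)

lemma finite_measure_density:
  assumes "integrable \<tau> f" "AE \<theta> in \<tau>. 0 \<le> f \<theta>"
  shows "finite_measure (density \<tau> f)"
    and "A \<in> sets \<tau> \<Longrightarrow> density_measure \<tau> f A = measure (density \<tau> f) A"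
proof -
  have e: "emeasure (density \<tau> f) A = ennreal (density_measure \<tau> f A)"
    and nn: "0 \<le> density_measure \<tau> f A" if A: "A \<in> sets \<tau>" for A
  proof -
    have int: "integrable \<tau> (\<lambda>\<theta>. indicator A \<theta> * f \<theta>)"
      using integrable_mult_indicator[OF A assms(1)] by simp
    have "emeasure (density \<tau> f) A = (\<integral>\<^sup>+\<theta>. ennreal (f \<theta>) * indicator A \<theta> \<partial>\<tau>)"
      using assms A by (intro emeasure_density) auto
    also have "\<dots> = (\<integral>\<^sup>+\<theta>. ennreal (indicator A \<theta> * f \<theta>) \<partial>\<tau>)"
      by (intro nn_integral_cong) (auto simp: indicator_def)
    also have "\<dots> = ennreal (\<integral>\<theta>. indicator A \<theta> * f \<theta> \<partial>\<tau>)"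
      using assms(2) by (intro nn_integral_eq_integral[OF int]) (auto elim!: AE_mp)
    finally show "emeasure (density \<tau> f) A = ennreal (density_measure \<tau> f A)"
      by (simp add: density_measure_def set_lebesgue_integral_def)
    show "0 \<le> density_measure \<tau> f A"
      unfolding density_measure_def set_lebesgue_integral_def
      using assms(2) by (intro integral_nonneg_AE) (auto elim!: AE_mp)
  qed
  show "finite_measure (density \<tau> f)"
    by (rule finite_measureI) (simp add: e[of "space \<tau>"])
  show "A \<in> sets \<tau> \<Longrightarrow> density_measure \<tau> f A = measure (density \<tau> f) A"
    using e nn by (simp add: measure_def)
qed

lemma signed_integral_density:
  assumes "integrable \<tau> f" "AE \<theta> in \<tau>. 0 \<le> f \<theta>"
  shows "signed_integral \<tau> (density_measure \<tau> f) (feature obj) = mean f *\<^sub>R unit_ell2"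
proof -
  have "signed_integral \<tau> (density_measure \<tau> f) (feature obj) = integral\<^sup>L (density \<tau> f) (feature obj)"
    using finite_measure_density[OF assms] by (intro signed_integral_of_measure) auto
  also have "\<dots> = (\<integral>\<theta>. f \<theta> *\<^sub>R feature obj \<theta> \<partial>\<tau>)"
    using assms by (intro integral_density) (auto simp: obj_def)
  also have "\<dots> = (\<integral>\<theta>. (V \<theta> * f \<theta>) *\<^sub>R unit_ell2 \<partial>\<tau>)"
    by (simp add: mult.commute)
  also have "\<dots> = mean f *\<^sub>R unit_ell2"
    unfolding mean_def using integrable_V_mult[OF assms(1)] by (simp add: integral_scaleR_left)
  finally show ?thesis .
qed

lemma density_in_prob_measures_iff:
  assumes "integrable \<tau> f"
  shows "density_measure \<tau> f \<in> prob_measures S \<longleftrightarrow> prob_density f"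
proof
  have sp: "space S = space \<tau>" using sets_S by (rule sets_eq_imp_space_eq)
  have tot: "density_measure \<tau> f (space \<tau>) = integral\<^sup>L \<tau> f"
    unfolding density_measure_def set_lebesgue_integral_def
    by (intro Bochner_Integration.integral_cong) auto
  {
    assume "density_measure \<tau> f \<in> prob_measures S"
    then have nn: "0 \<le> density_measure \<tau> f A" if "A \<in> sets \<tau>" for A
      using that by (auto simp: prob_measures_def nonneg_measures_def sets_S)
    have "density_measure \<tau> f (space S) = 1"
      using \<open>density_measure \<tau> f \<in> prob_measures S\<close> by (simp add: prob_measures_def)
    then have "integral\<^sup>L \<tau> f = 1" using tot sp by simp
    moreover have "AE \<theta> in \<tau>. 0 \<le> f \<theta>"
    proof -
      \<comment> \<open>Test on the set where \<open>f\<close> is negative: there the integral of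
        \<open>- f\<close> is nonnegative by sign and nonpositive by assumption, hence 0.\<close>
      define A where "A = {\<theta> \<in> space \<tau>. f \<theta> < 0}"
      have [measurable]: "f \<in> borel_measurable \<tau>" using assms by auto
      have A: "A \<in> sets \<tau>" unfolding A_def by measurable
      define g where "g \<theta> = - (indicator A \<theta> * f \<theta>)" for \<theta>
      have int: "integrable \<tau> g"
        unfolding g_def using integrable_mult_indicator[OF A assms] by simp
      have g0: "AE \<theta> in \<tau>. 0 \<le> g \<theta>" by (auto simp: g_def A_def indicator_def)
      have "integral\<^sup>L \<tau> g = - density_measure \<tau> f A"
        by (simp add: g_def[abs_def] density_measure_def set_lebesgue_integral_def)
      then have "integral\<^sup>L \<tau> g = 0"
        using nn[OF A] integral_nonneg_AE[OF g0] by linarith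
      then have "AE \<theta> in \<tau>. g \<theta> = 0"
        using integral_nonneg_eq_0_iff_AE[OF int g0] by simp
      then show ?thesis
        by (rule AE_mp) (auto simp: g_def A_def indicator_def intro!: AE_I2)
    qed
    ultimately show "prob_density f" using assms by (simp add: prob_density_def)
  }
  {
    assume f: "prob_density f"
    then have f': "integrable \<tau> f" "AE \<theta> in \<tau>. 0 \<le> f \<theta>" by (auto simp: prob_density_def)
    have "signed_measure S (density_measure \<tau> f)"
      using finite_measure_density[OF f'] by (intro signed_measure_of_measure) (auto simp: sets_S)
    moreover have "0 \<le> density_measure \<tau> f A" if "A \<in> sets S" for A
      using finite_measure_density(2)[OF f'] that by (simp add: sets_S)
    ultimately show "density_measure \<tau> f \<in> prob_measures S"
      using f tot by (auto simp: prob_measures_def nonneg_measures_def prob_density_def sp)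
  }
qed

lemma mean_nonneg: "prob_density f \<Longrightarrow> 0 \<le> mean f"
  unfolding mean_def prob_density_def
  by (intro integral_nonneg_AE, elim conjE, erule AE_mp) (auto intro!: AE_I2 simp: V_nonneg)

lemma F_fun_obj:
  assumes "integrable \<tau> f"
  shows "F_fun \<tau> obj f = (if prob_density f then ereal (mean f ^ p / p) else \<infinity>)"
proof (cases "prob_density f")
  case True
  then have "signed_integral \<tau> (density_measure \<tau> f) (feature obj) = mean f *\<^sub>R unit_ell2"
    by (intro signed_integral_density) (auto simp: prob_density_def)
  then show ?thesis
    using True density_in_prob_measures_iff[OF assms]
    by (simp add: F_fun_def F_bar_def G_bar_def convex_indicator_def ray_loss_def)
next
  case False
  then show ?thesis
    using density_in_prob_measures_iff[OF assms]
    by (simp add: F_fun_def F_bar_def convex_indicator_def)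
qed

lemma inf_F_nonneg: "0 \<le> inf_F \<tau> obj"
  unfolding inf_F_def by (rule INF_greatest) (auto simp: F_fun_obj mean_nonneg)

lemma bregman_eta2: "bregman \<tau> eta2 f g = enn2ereal (\<integral>\<^sup>+\<theta>. ennreal ((f \<theta> - g \<theta>)\<^sup>2 / 2) \<partial>\<tau>)"
proof -
  have "(eta2 has_field_derivative x) (at x)" for x
    unfolding eta2_def by (auto intro!: derivative_eq_intros)
  then have "deriv eta2 x = x" for x by (rule DERIV_imp_deriv)
  moreover have "eta2 a - eta2 b - b * (a - b) = (a - b)\<^sup>2 / 2" for a b
    by (simp add: eta2_def power2_eq_square field_simps)
  ultimately show ?thesis by (simp only: bregman_def)
qed

text \<open>The quadratic term stays a nonnegative integral: an integrable competitor may fail to be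
  square integrable, and then its divergence is infinite.\<close>

lemma prox_objective_obj:
  assumes "prob_density g" "integrable \<tau> f"
  shows "prox_objective \<tau> obj eta2 s g f =
    (if prob_density f
     then ereal (mean g ^ p / p + mean g ^ (p - 1) * (mean f - mean g)) +
       ereal (1 / s) * enn2ereal (\<integral>\<^sup>+\<theta>. ennreal ((f \<theta> - g \<theta>)\<^sup>2 / 2) \<partial>\<tau>)
     else \<infinity>)"
proof (cases "prob_density f")
  case False
  then have "prox_objective \<tau> obj eta2 s g f = \<infinity> "
    using density_in_prob_measures_iff[OF assms(2)]
    by (simp add: prox_objective_def convex_indicator_def)
  then show ?thesis using False by simp
next
  case True
  have int: "integrable \<tau> g" using assms by (simp add: prob_density_def)
  have sg: "signed_integral \<tau> (density_measure \<tau> g) (feature obj) = mean g *\<^sub>R unit_ell2"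
    using assms(1) by (intro signed_integral_density) (auto simp: prob_density_def)
  have "(\<integral>\<theta>. G_bar_diff \<tau> obj (density_measure \<tau> g) \<theta> * (f \<theta> - g \<theta>) \<partial>\<tau>)
      = (\<integral>\<theta>. mean g ^ (p - 1) * (V \<theta> * f \<theta> - V \<theta> * g \<theta>) \<partial>\<tau>)"
    by (simp add: G_bar_diff_def sg gradient_ray_loss[OF p_pos] algebra_simps)
  also have "\<dots> = mean g ^ (p - 1) * (mean f - mean g)"
    using assms(2) int by (simp add: mean_def Bochner_Integration.integral_diff integrable_V_mult)
  finally show ?thesis
    using True density_in_prob_measures_iff[OF assms(2)] sg
    by (simp add: prox_objective_def convex_indicator_def bregman_eta2 G_bar_def ray_loss_def)
qed

text \<open>Carries a proximal problem over from an iterate known up to null sets to its explicit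
  representative.\<close>

lemma prox_objective_cong_AE:
  assumes "prob_density g" "prob_density g'" "AE \<theta> in \<tau>. g \<theta> = g' \<theta>" "integrable \<tau> f"
  shows "prox_objective \<tau> obj eta2 s g f = prox_objective \<tau> obj eta2 s g' f"
proof -
  have [measurable]: "g \<in> borel_measurable \<tau>" "g' \<in> borel_measurable \<tau>"
    using assms by (auto simp: prob_density_def)
  have "mean g = mean g'"
    unfolding mean_def using assms(3) by (intro integral_cong_AE) (auto elim!: AE_mp)
  moreover have "(\<integral>\<^sup>+\<theta>. ennreal ((f \<theta> - g \<theta>)\<^sup>2 / 2) \<partial>\<tau>) = (\<integral>\<^sup>+\<theta>. ennreal ((f \<theta> - g' \<theta>)\<^sup>2 / 2) \<partial>\<tau>)"
    using assms(3) by (intro nn_integral_cong_AE) (auto elim!: AE_mp)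
  ultimately show ?thesis
    by (simp add: prox_objective_obj assms)
qed

section \<open>A proximal step certified by pointwise optimality\<close>

text \<open>\<open>opt\<close> is the pointwise variational inequality for a candidate
  \<open>h\<close>, with \<open>c\<close> as Lagrange multiplier of the mass constraint;
  \<open>bounded\<close> makes the product of \<open>f - h\<close> and \<open>h - g\<close>
  integrable.\<close>

context
  fixes s c K :: real and g h :: "'p \<Rightarrow> real"
  assumes s: "0 < s" and g: "prob_density g" and h: "prob_density h"
    and bounded: "\<And>\<theta>. \<theta> \<in> space \<tau> \<Longrightarrow> \<bar>h \<theta> - g \<theta>\<bar> \<le> K"
    and opt: "\<And>\<theta> t. \<theta> \<in> space \<tau> \<Longrightarrow> 0 \<le> t \<Longrightarrow>
      c * (t - h \<theta>) \<le> (t - h \<theta>) * (s * mean g ^ (p - 1) * V \<theta> + h \<theta> - g \<theta>)"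
begin

lemma prox_objective_finite:
  assumes "prob_density f" "integrable \<tau> (\<lambda>\<theta>. (f \<theta> - g \<theta>)\<^sup>2)"
  shows "prox_objective \<tau> obj eta2 s g f = ereal (mean g ^ p / p +
    mean g ^ (p - 1) * (mean f - mean g) + 1 / (2 * s) * (\<integral>\<theta>. (f \<theta> - g \<theta>)\<^sup>2 \<partial>\<tau>))"
proof -
  have "(\<integral>\<^sup>+\<theta>. ennreal ((f \<theta> - g \<theta>)\<^sup>2 / 2) \<partial>\<tau>) = ennreal (\<integral>\<theta>. (f \<theta> - g \<theta>)\<^sup>2 / 2 \<partial>\<tau>)"
    using assms(2) by (intro nn_integral_eq_integral) auto
  then show ?thesis
    using assms(1) by (simp add: prox_objective_obj[OF g] prob_density_def enn2ereal_ennreal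
        field_simps)
qed

lemma integrable_step: "integrable \<tau> (\<lambda>\<theta>. (h \<theta> - g \<theta>)\<^sup>2)"
proof (rule integrable_const_bound[where B = "K\<^sup>2"])
  show "AE \<theta> in \<tau>. norm ((h \<theta> - g \<theta>)\<^sup>2) \<le> K\<^sup>2"
    using bounded power_mono[of "\<bar>h _ - g _\<bar>" K 2] by (auto intro!: AE_I2)
  show "(\<lambda>\<theta>. (h \<theta> - g \<theta>)\<^sup>2) \<in> borel_measurable \<tau>"
    using g h by (auto simp: prob_density_def)
qed

text \<open>Strong convexity: \<open>h\<close> beats a competitor by its squared distance over
  \<open>2 * s\<close>. Integrate \<open>opt\<close> with \<open>t = f \<theta>\<close>; the
  multiplier drops out because \<open>f\<close> and \<open>h\<close> both have integral 1.\<close>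

lemma prox_gap:
  assumes f: "prob_density f" and int: "integrable \<tau> (\<lambda>\<theta>. (f \<theta> - g \<theta>)\<^sup>2)"
  shows "integrable \<tau> (\<lambda>\<theta>. (f \<theta> - h \<theta>)\<^sup>2)"
    and "mean g ^ (p - 1) * (mean h - mean g) + 1 / (2 * s) * (\<integral>\<theta>. (h \<theta> - g \<theta>)\<^sup>2 \<partial>\<tau>)
      + 1 / (2 * s) * (\<integral>\<theta>. (f \<theta> - h \<theta>)\<^sup>2 \<partial>\<tau>)
      \<le> mean g ^ (p - 1) * (mean f - mean g) + 1 / (2 * s) * (\<integral>\<theta>. (f \<theta> - g \<theta>)\<^sup>2 \<partial>\<tau>)"
proof -
  have ints: "integrable \<tau> f" "integrable \<tau> g" "integrable \<tau> h" "integral\<^sup>L \<tau> f = 1" "integral\<^sup>L \<tau> h = 1"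
    and AEf: "AE \<theta> in \<tau>. 0 \<le> f \<theta>"
    using f g h by (auto simp: prob_density_def)
  have cross: "integrable \<tau> (\<lambda>\<theta>. (f \<theta> - h \<theta>) * (h \<theta> - g \<theta>))"
  proof (rule Bochner_Integration.integrable_bound[where f = "\<lambda>\<theta>. K * (f \<theta> - h \<theta>)"])
    show "AE \<theta> in \<tau>. norm ((f \<theta> - h \<theta>) * (h \<theta> - g \<theta>)) \<le> norm (K * (f \<theta> - h \<theta>))"
    proof (rule AE_I2)
      fix \<theta> assume "\<theta> \<in> space \<tau>"
      then have "\<bar>h \<theta> - g \<theta>\<bar> \<le> \<bar>K\<bar>" using bounded[of \<theta>] by linarith
      then show "norm ((f \<theta> - h \<theta>) * (h \<theta> - g \<theta>)) \<le> norm (K * (f \<theta> - h \<theta>))"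
        using mult_left_mono[of "\<bar>h \<theta> - g \<theta>\<bar>" "\<bar>K\<bar>" "\<bar>f \<theta> - h \<theta>\<bar>"]
        by (simp add: abs_mult mult.commute)
    qed
  qed (use ints in auto)
  \<comment> \<open>The three-point identity, which turns the cross term of \<open>opt\<close> into
    a difference of the two divergences.\<close>
  have exp: "(f \<theta> - h \<theta>)\<^sup>2 = (f \<theta> - g \<theta>)\<^sup>2 - 2 * ((f \<theta> - h \<theta>) * (h \<theta> - g \<theta>)) - (h \<theta> - g \<theta>)\<^sup>2" for \<theta>
    by (simp add: power2_eq_square algebra_simps)
  show sq: "integrable \<tau> (\<lambda>\<theta>. (f \<theta> - h \<theta>)\<^sup>2)"
    unfolding exp using int cross integrable_step by auto
  have I: "(\<integral>\<theta>. (f \<theta> - h \<theta>)\<^sup>2 \<partial>\<tau>) = (\<integral>\<theta>. (f \<theta> - g \<theta>)\<^sup>2 \<partial>\<tau>)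
      - 2 * (\<integral>\<theta>. (f \<theta> - h \<theta>) * (h \<theta> - g \<theta>) \<partial>\<tau>) - (\<integral>\<theta>. (h \<theta> - g \<theta>)\<^sup>2 \<partial>\<tau>)"
    unfolding exp using int cross integrable_step by simp
  define \<gamma>' where "\<gamma>' = mean g ^ (p - 1)"
  have "(\<integral>\<theta>. c * (f \<theta> - h \<theta>) \<partial>\<tau>)
      \<le> (\<integral>\<theta>. s * \<gamma>' * (V \<theta> * f \<theta> - V \<theta> * h \<theta>) + (f \<theta> - h \<theta>) * (h \<theta> - g \<theta>) \<partial>\<tau>)"
  proof (rule integral_mono_AE)
    show "AE \<theta> in \<tau>. c * (f \<theta> - h \<theta>)
        \<le> s * \<gamma>' * (V \<theta> * f \<theta> - V \<theta> * h \<theta>) + (f \<theta> - h \<theta>) * (h \<theta> - g \<theta>)"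
      using AEf
    proof (rule AE_mp, intro AE_I2 impI)
      fix \<theta> assume "\<theta> \<in> space \<tau>" "0 \<le> f \<theta>"
      from opt[OF this] show "c * (f \<theta> - h \<theta>)
          \<le> s * \<gamma>' * (V \<theta> * f \<theta> - V \<theta> * h \<theta>) + (f \<theta> - h \<theta>) * (h \<theta> - g \<theta>)"
        by (simp add: \<gamma>'_def algebra_simps)
    qed
  qed (use ints cross in \<open>auto intro!: integrable_V_mult Bochner_Integration.integrable_add
        Bochner_Integration.integrable_diff integrable_mult_right\<close>)
  also have "\<dots> = s * \<gamma>' * (mean f - mean h) + (\<integral>\<theta>. (f \<theta> - h \<theta>) * (h \<theta> - g \<theta>) \<partial>\<tau>)"
    using ints cross by (simp add: mean_def integrable_V_mult)
  finally have "0 \<le> s * \<gamma>' * (mean f - mean h) + (\<integral>\<theta>. (f \<theta> - h \<theta>) * (h \<theta> - g \<theta>) \<partial>\<tau>)"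
    using ints by simp
  then show "mean g ^ (p - 1) * (mean h - mean g) + 1 / (2 * s) * (\<integral>\<theta>. (h \<theta> - g \<theta>)\<^sup>2 \<partial>\<tau>)
      + 1 / (2 * s) * (\<integral>\<theta>. (f \<theta> - h \<theta>)\<^sup>2 \<partial>\<tau>)
      \<le> mean g ^ (p - 1) * (mean f - mean g) + 1 / (2 * s) * (\<integral>\<theta>. (f \<theta> - g \<theta>)\<^sup>2 \<partial>\<tau>)"
    unfolding I \<gamma>'_def[symmetric]
  proof -
    fix X assume "0 \<le> s * \<gamma>' * (mean f - mean h) + X"
    then have "0 \<le> (s * \<gamma>' * (mean f - mean h) + X) / s" using s by simp
    also have "\<dots> = \<gamma>' * (mean f - mean g) - \<gamma>' * (mean h - mean g) + X / s"
      using s by (simp add: add_divide_distrib diff_divide_distrib right_diff_distrib)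
    finally show "\<gamma>' * (mean h - mean g) + 1 / (2 * s) * Z + 1 / (2 * s) * (Y - 2 * X - Z)
        \<le> \<gamma>' * (mean f - mean g) + 1 / (2 * s) * Y" for Y Z
      using s by (simp add: right_diff_distrib)
  qed
qed

text \<open>A competitor at least as good as \<open>h\<close> has finite value, so it is a density
  at finite squared distance from \<open>g\<close>, and the gap forces its distance from
  \<open>h\<close> to be 0.\<close>

lemma prox_not_less:
  assumes "integrable \<tau> f" "prox_objective \<tau> obj eta2 s g f \<le> prox_objective \<tau> obj eta2 s g h"
  shows "prox_objective \<tau> obj eta2 s g f = prox_objective \<tau> obj eta2 s g h"
    and "AE \<theta> in \<tau>. f \<theta> = h \<theta>"
proof -
  note hval = prox_objective_finite[OF h integrable_step]
  have f: "prob_density f"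
    using assms hval prox_objective_obj[OF g assms(1), of s] by (auto split: if_splits)
  have [measurable]: "f \<in> borel_measurable \<tau>" "g \<in> borel_measurable \<tau>" "h \<in> borel_measurable \<tau>"
    using f g h by (auto simp: prob_density_def)
  have int: "integrable \<tau> (\<lambda>\<theta>. (f \<theta> - g \<theta>)\<^sup>2)"
  proof -
    have "(\<integral>\<^sup>+\<theta>. ennreal ((f \<theta> - g \<theta>)\<^sup>2 / 2) \<partial>\<tau>) \<noteq> \<infinity>"
    proof
      assume "(\<integral>\<^sup>+\<theta>. ennreal ((f \<theta> - g \<theta>)\<^sup>2 / 2) \<partial>\<tau>) = \<infinity>"
      then have "prox_objective \<tau> obj eta2 s g f = \<infinity>"
        using f s by (simp add: prox_objective_obj[OF g assms(1)])
      then show False using assms(2) hval by simp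
    qed
    then have "integrable \<tau> (\<lambda>\<theta>. (f \<theta> - g \<theta>)\<^sup>2 / 2)"
      by (intro integrableI_bounded) (auto simp: top.not_eq_extremum)
    from integrable_mult_right[OF this, of 2] show ?thesis by simp
  qed
  note gap = prox_gap[OF f int]
  have nn: "0 \<le> (\<integral>\<theta>. (f \<theta> - h \<theta>)\<^sup>2 \<partial>\<tau>)" by simp
  have le: "1 / (2 * s) * (\<integral>\<theta>. (f \<theta> - h \<theta>)\<^sup>2 \<partial>\<tau>) \<le> 0"
    using gap(2) assms(2) unfolding hval prox_objective_finite[OF f int] by simp
  then have z: "(\<integral>\<theta>. (f \<theta> - h \<theta>)\<^sup>2 \<partial>\<tau>) = 0"
    using nn s by (simp add: divide_le_0_iff)
  then show "AE \<theta> in \<tau>. f \<theta> = h \<theta>"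
    using integral_nonneg_eq_0_iff_AE[OF gap(1)] by simp
  show "prox_objective \<tau> obj eta2 s g f = prox_objective \<tau> obj eta2 s g h"
    using gap(2) assms(2) unfolding hval prox_objective_finite[OF f int] z by simp
qed

lemma is_arg_min_prox: "is_arg_min (prox_objective \<tau> obj eta2 s g) (integrable \<tau>) h"
proof -
  have "\<not> prox_objective \<tau> obj eta2 s g f < prox_objective \<tau> obj eta2 s g h" if "integrable \<tau> f" for f
    using prox_not_less(1)[OF that] by (metis less_imp_le less_irrefl)
  then show ?thesis using h by (auto simp: is_arg_min_def prob_density_def)
qed

lemma is_arg_min_prox_unique:
  assumes "is_arg_min (prox_objective \<tau> obj eta2 s g) (integrable \<tau>) f"
  shows "AE \<theta> in \<tau>. f \<theta> = h \<theta>"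
  using assms h by (intro prox_not_less) (auto simp: is_arg_min_def prob_density_def not_less)

end

end

section \<open>The iterates and their decay\<close>

text \<open>\<open>\<beta>\<close> is the growth exponent of the sublevel volumes,
  \<open>d / r\<close> on the torus. The lower bound stops at \<open>B\<close>, where the sublevel
  set is already the whole space.\<close>

locale power_potential = potential +
  fixes c1 C2 \<beta> :: real
  assumes B_pos: "0 < B" and c1_pos: "0 < c1" and C2_pos: "0 < C2" and \<beta>_pos: "0 < \<beta>"
    and sublevel_lower: "\<And>\<delta>. 0 \<le> \<delta> \<Longrightarrow> \<delta> \<le> B \<Longrightarrow>
      c1 * \<delta> powr \<beta> \<le> measure \<tau> {\<theta> \<in> space \<tau>. V \<theta> \<le> \<delta>}"
    and sublevel_upper: "\<And>\<delta>. 0 \<le> \<delta> \<Longrightarrow>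
      measure \<tau> {\<theta> \<in> space \<tau>. V \<theta> \<le> \<delta>} \<le> C2 * \<delta> powr \<beta>"
begin

definition cut :: "real \<Rightarrow> real \<Rightarrow> 'a \<Rightarrow> real" where
  "cut l A \<theta> = max 0 (l - A * V \<theta>)"

lemma cut_nonneg [simp]: "0 \<le> cut l A \<theta>" by (simp add: cut_def)

lemma cut_le: "0 \<le> l \<Longrightarrow> 0 \<le> A \<Longrightarrow> \<theta> \<in> space \<tau> \<Longrightarrow> cut l A \<theta> \<le> l"
  using V_nonneg[of \<theta>] by (simp add: cut_def)

lemma cut_measurable [measurable]: "cut l A \<in> borel_measurable \<tau>"
  unfolding cut_def[abs_def] by measurable

lemma integrable_cut [simp]: "integrable \<tau> (cut l A)"
proof (rule integrable_const_bound[where B = "\<bar>l\<bar> + \<bar>A\<bar> * B"])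
  show "AE \<theta> in \<tau>. norm (cut l A \<theta>) \<le> \<bar>l\<bar> + \<bar>A\<bar> * B"
  proof (rule AE_I2)
    fix \<theta> assume "\<theta> \<in> space \<tau>"
    then have "\<bar>A\<bar> * \<bar>V \<theta>\<bar> \<le> \<bar>A\<bar> * B" by (intro mult_left_mono abs_V_le) auto
    moreover have "\<bar>A * V \<theta>\<bar> = \<bar>A\<bar> * \<bar>V \<theta>\<bar>" by (rule abs_mult)
    moreover have "\<bar>cut l A \<theta>\<bar> \<le> \<bar>l\<bar> + \<bar>A * V \<theta>\<bar>" unfolding cut_def by linarith
    ultimately show "norm (cut l A \<theta>) \<le> \<bar>l\<bar> + \<bar>A\<bar> * B" by simp
  qed
qed simp

abbreviation total :: "real \<Rightarrow> real \<Rightarrow> real" where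
  "total l A \<equiv> integral\<^sup>L \<tau> (cut l A)"

lemma total_Lipschitz: "\<bar>total l A - total l' A\<bar> \<le> \<bar>l - l'\<bar>"
proof -
  have "\<bar>total l A - total l' A\<bar> = \<bar>\<integral>\<theta>. cut l A \<theta> - cut l' A \<theta> \<partial>\<tau>\<bar>"
    by (subst Bochner_Integration.integral_diff) auto
  also have "\<dots> \<le> (\<integral>\<theta>. \<bar>cut l A \<theta> - cut l' A \<theta>\<bar> \<partial>\<tau>)" by (rule integral_abs_bound)
  also have "\<dots> \<le> (\<integral>\<theta>. \<bar>l - l'\<bar> \<partial>\<tau>)"
    by (rule integral_mono, intro integrable_abs Bochner_Integration.integrable_diff integrable_cut)
      (auto simp: cut_def)
  finally show ?thesis by (simp add: mass)
qed

text \<open>Intermediate values: level 0 gives mass 0, and level \<open>1 + A * B\<close> gives a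
  function that is at least 1 everywhere.\<close>

lemma level_exists:
  assumes "0 \<le> A"
  shows "\<exists>l>0. total l A = 1"
proof -
  have "continuous_on {0..1 + A * B} (\<lambda>l. total l A)"
    by (rule lipschitz_on_continuous_on[of 1], rule lipschitz_onI)
      (use total_Lipschitz in \<open>auto simp: dist_real_def\<close>)
  moreover have z: "total 0 A = 0"
  proof -
    have "total 0 A = (\<integral>\<theta>. 0 \<partial>\<tau>)"
      using assms V_nonneg by (intro Bochner_Integration.integral_cong) (auto simp: cut_def)
    then show ?thesis by simp
  qed
  moreover have "1 \<le> total (1 + A * B) A"
  proof -
    have "(\<integral>\<theta>. 1 \<partial>\<tau>) \<le> total (1 + A * B) A"
    proof (rule integral_mono)
      fix \<theta> assume "\<theta> \<in> space \<tau>"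
      then have "A * V \<theta> \<le> A * B" using assms V_le by (intro mult_left_mono)
      then show "1 \<le> cut (1 + A * B) A \<theta>" by (simp add: cut_def)
    qed auto
    then show ?thesis by (simp add: mass)
  qed
  moreover have "0 \<le> 1 + A * B" using assms B_pos by simp
  ultimately obtain l where l: "0 \<le> l" "total l A = 1"
    using IVT'[of "\<lambda>l. total l A" 0 1 "1 + A * B"] by auto
  then have "l \<noteq> 0" using z by auto
  then show ?thesis using l by (intro exI[of _ l]) simp
qed

definition level :: "real \<Rightarrow> real" where
  "level A = (SOME l. 0 < l \<and> total l A = 1)"

definition dens :: "real \<Rightarrow> 'a \<Rightarrow> real" where
  "dens A = cut (level A) A"

lemma level:
  assumes "0 \<le> A"
  shows "0 < level A" "total (level A) A = 1"
  using someI_ex[OF level_exists[OF assms]] unfolding level_def by auto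

lemma prob_density_dens: "0 \<le> A \<Longrightarrow> prob_density (dens A)"
  using level by (simp add: prob_density_def dens_def)

lemma integrable_dens [simp]: "integrable \<tau> (dens A)" by (simp add: dens_def)

lemma integral_dens: "0 \<le> A \<Longrightarrow> integral\<^sup>L \<tau> (dens A) = 1" by (simp add: dens_def level)

lemma dens_nonneg [simp]: "0 \<le> dens A \<theta>" by (simp add: dens_def)

lemma level_0: "level 0 = 1"
proof -
  have "total (level 0) 0 = (\<integral>\<theta>. level 0 \<partial>\<tau>)"
    using level(1)[of 0] by (intro Bochner_Integration.integral_cong) (auto simp: cut_def)
  then show ?thesis using level(2)[of 0] by (simp add: mass)
qed

lemma dens_0: "dens 0 = (\<lambda>_. 1)"
  by (simp add: dens_def cut_def level_0 fun_eq_iff)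

text \<open>Both densities have integral 1. This excludes domination with a factor below 1, from
  which both monotonicity properties of the level follow.\<close>

lemma cut_factor_ge_1:
  assumes "0 \<le> A" "0 \<le> A'" "0 \<le> r" "\<And>\<theta>. \<theta> \<in> space \<tau> \<Longrightarrow> dens A \<theta> \<le> r * dens A' \<theta>"
  shows "1 \<le> r"
proof -
  have "integral\<^sup>L \<tau> (dens A) \<le> (\<integral>\<theta>. r * dens A' \<theta> \<partial>\<tau>)"
    using assms by (intro integral_mono) auto
  then show ?thesis using assms by (simp add: integral_dens)
qed

text \<open>If the level dropped, \<open>dens A\<close> scaled by \<open>level A' / level A\<close>
  would dominate \<open>dens A'\<close> with a factor below 1.\<close>

lemma level_mono:
  assumes "0 \<le> A" "A \<le> A'"
  shows "level A \<le> level A'"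
proof (rule ccontr)
  assume less: "\<not> level A \<le> level A'"
  have pos: "0 < level A" "0 < level A'" using assms level by auto
  have "1 \<le> level A' / level A"
  proof (rule cut_factor_ge_1[of A' A])
    fix \<theta> assume \<theta>: "\<theta> \<in> space \<tau>"
    have "level A' / level A * A \<le> 1 * A"
      using less pos assms by (intro mult_right_mono) auto
    then have "level A' / level A * A * V \<theta> \<le> A' * V \<theta>"
      using assms V_nonneg[OF \<theta>] by (intro mult_right_mono) auto
    moreover have "level A' / level A * (level A - A * V \<theta>)
        = level A' - level A' / level A * A * V \<theta>"
      using pos by (simp add: field_simps)
    moreover have "level A' / level A * (level A - A * V \<theta>) \<le> level A' / level A * dens A \<theta>"
      using pos by (intro mult_left_mono) (auto simp: dens_def cut_def)
    ultimately have "level A' - A' * V \<theta> \<le> level A' / level A * dens A \<theta>" by linarith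
    then show "dens A' \<theta> \<le> level A' / level A * dens A \<theta>"
      using pos by (simp add: dens_def cut_def)
  qed (use assms pos in auto)
  then show False using less pos by (simp add: field_simps)
qed

text \<open>The height \<open>level A / A\<close> at which \<open>V\<close> is cut off decreases, so
  the supports shrink; the cross-multiplied form covers \<open>A = 0\<close>. Otherwise
  \<open>dens A'\<close> scaled by \<open>A / A'\<close> would dominate \<open>dens A\<close> with a
  factor below 1.\<close>

lemma level_ratio_antimono:
  assumes "0 \<le> A" "A \<le> A'"
  shows "level A' * A \<le> level A * A'"
proof (rule ccontr)
  assume less: "\<not> level A' * A \<le> level A * A'"
  have pos: "0 < level A" "0 < level A'" using assms level by auto
  have ne: "A \<noteq> A'" using less by auto
  then have A': "0 < A'" using assms by linarith
  have "1 \<le> A / A'"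
  proof (rule cut_factor_ge_1[of A A'])
    fix \<theta> assume \<theta>: "\<theta> \<in> space \<tau>"
    have "level A \<le> A / A' * level A'" using less A' by (simp add: field_simps)
    moreover have "A / A' * (level A' - A' * V \<theta>) = A / A' * level A' - A * V \<theta>"
      using A' by (simp add: field_simps)
    moreover have "A / A' * (level A' - A' * V \<theta>) \<le> A / A' * dens A' \<theta>"
      using assms by (intro mult_left_mono) (auto simp: dens_def cut_def)
    ultimately have "level A - A * V \<theta> \<le> A / A' * dens A' \<theta>" by linarith
    then show "dens A \<theta> \<le> A / A' * dens A' \<theta>"
      using assms by (simp add: dens_def cut_def)
  qed (use assms in auto)
  then show False using ne assms A' by (simp add: field_simps)
qed

text \<open>The multiplier is the increase of the level. Where \<open>dens A'\<close> is positive
  neither cut is active and equality holds; elsewhere \<open>dens A'\<close> is 0, and as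
  \<open>t\<close> is nonnegative an inequality between the other factors suffices.\<close>

lemma dens_optimality:
  assumes "0 \<le> A" "A \<le> A'" and \<theta>: "\<theta> \<in> space \<tau>" and "0 \<le> t"
  shows "(level A' - level A) * (t - dens A' \<theta>)
    \<le> (t - dens A' \<theta>) * ((A' - A) * V \<theta> + dens A' \<theta> - dens A \<theta>)"
proof -
  note V = V_nonneg[OF \<theta>]
  have pos: "0 < level A" "0 < level A'" using assms level by auto
  note mono = level_mono[OF assms(1,2)] and ratio = level_ratio_antimono[OF assms(1,2)]
  consider "A' * V \<theta> < level A'" | "level A' \<le> A' * V \<theta>" by linarith
  then show ?thesis
  proof cases
    case 1
    \<comment> \<open>The supports shrink, so a point of the new support is uncut in the old density
      as well.\<close>
    have "A * V \<theta> \<le> level A"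
    proof (cases "A = 0")
      case False
      have "A' * (A * V \<theta>) = A * (A' * V \<theta>)" by simp
      also have "\<dots> \<le> A * level A'" using 1 assms by (intro mult_left_mono) auto
      also have "\<dots> \<le> A' * level A" using ratio by (simp add: mult.commute)
      finally show ?thesis using False assms by (simp add: mult_le_cancel_left_pos)
    qed (use pos in simp)
    then show ?thesis using 1 by (simp add: dens_def cut_def algebra_simps)
  next
    case 2
    then have h: "dens A' \<theta> = 0" by (simp add: dens_def cut_def)
    have "level A' - level A \<le> (A' - A) * V \<theta> - dens A \<theta>"
    \<comment> \<open>A point outside the new support may lie in the old one or outside both; in the
      latter case the monotone ratio decides.\<close>
    proof (cases "A * V \<theta> \<le> level A")
      case True
      then show ?thesis using 2 by (simp add: dens_def cut_def algebra_simps)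
    next
      case False
      then have A: "0 < A" using assms pos by (cases "A = 0") auto
      have "A * (level A' - level A) \<le> (A' - A) * level A" using ratio by (simp add: algebra_simps)
      also have "\<dots> \<le> (A' - A) * (A * V \<theta>)" using False assms by (intro mult_left_mono) auto
      also have "\<dots> = A * ((A' - A) * V \<theta>)" by simp
      finally have "level A' - level A \<le> (A' - A) * V \<theta>" using A by (simp add: mult_le_cancel_left_pos)
      then show ?thesis using False by (simp add: dens_def cut_def)
    qed
    from mult_left_mono[OF this \<open>0 \<le> t\<close>] show ?thesis by (simp add: h mult.commute)
  qed
qed

section \<open>The explicit iterates\<close>

primrec weight :: "real \<Rightarrow> nat \<Rightarrow> real" where
  "weight s 0 = 0"
| "weight s (Suc k) = weight s k + s * mean (dens (weight s k)) ^ (p - 1)"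

lemma mean_dens_nonneg: "0 \<le> mean (dens A)"
  unfolding mean_def by (intro integral_nonneg_AE AE_I2) (simp add: V_nonneg)

lemma weight_nonneg: "0 \<le> s \<Longrightarrow> 0 \<le> weight s k"
  by (induction k) (auto simp: mean_dens_nonneg)

lemma weight_mono: "0 \<le> s \<Longrightarrow> weight s k \<le> weight s (Suc k)"
  by (simp add: mean_dens_nonneg)

lemma dens_step_bounded:
  assumes "0 \<le> A" "0 \<le> A'" "\<theta> \<in> space \<tau>"
  shows "\<bar>dens A' \<theta> - dens A \<theta>\<bar> \<le> level A' + level A"
proof -
  have "dens A \<theta> \<le> level A" "dens A' \<theta> \<le> level A'"
    unfolding dens_def using assms level(1)[of A] level(1)[of A'] by (auto intro!: cut_le)
  then show ?thesis using dens_nonneg[of A \<theta>] dens_nonneg[of A' \<theta>] by linarith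
qed

lemma
  assumes "0 < s"
  shows is_arg_min_dens:
      "is_arg_min (prox_objective \<tau> obj eta2 s (dens (weight s k))) (integrable \<tau>) (dens (weight s (Suc k)))"
    and is_arg_min_dens_unique:
      "is_arg_min (prox_objective \<tau> obj eta2 s (dens (weight s k))) (integrable \<tau>) f \<Longrightarrow>
        AE \<theta> in \<tau>. f \<theta> = dens (weight s (Suc k)) \<theta>"
proof -
  define A A' where "A = weight s k" and "A' = weight s (Suc k)"
  have A: "0 \<le> A" "0 \<le> A'" "A \<le> A'"
    using assms weight_nonneg weight_mono by (auto simp: A_def A'_def simp del: weight.simps)
  have step: "A' - A = s * mean (dens A) ^ (p - 1)" by (simp add: A_def A'_def)
  have opt: "(level A' - level A) * (t - dens A' \<theta>)
      \<le> (t - dens A' \<theta>) * (s * mean (dens A) ^ (p - 1) * V \<theta> + dens A' \<theta> - dens A \<theta>)"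
    if "\<theta> \<in> space \<tau>" "0 \<le> t" for \<theta> t
    using dens_optimality[OF A(1,3) that] unfolding step .
  note facts = assms prob_density_dens[OF A(1)] prob_density_dens[OF A(2)]
    dens_step_bounded[OF A(1,2)] opt
  show "is_arg_min (prox_objective \<tau> obj eta2 s (dens (weight s k))) (integrable \<tau>) (dens (weight s (Suc k)))"
    using is_arg_min_prox[OF facts] unfolding A_def A'_def .
  show "is_arg_min (prox_objective \<tau> obj eta2 s (dens (weight s k))) (integrable \<tau>) f \<Longrightarrow>
        AE \<theta> in \<tau>. f \<theta> = dens (weight s (Suc k)) \<theta>"
    using is_arg_min_prox_unique[OF facts] unfolding A_def A'_def .
qed

lemma prob_density_cong_AE:
  assumes "prob_density g" "integrable \<tau> f" "AE \<theta> in \<tau>. f \<theta> = g \<theta>"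
  shows "prob_density f" "mean f = mean g"
proof -
  have [measurable]: "f \<in> borel_measurable \<tau>" "g \<in> borel_measurable \<tau>"
    using assms by (auto simp: prob_density_def)
  have "integral\<^sup>L \<tau> f = integral\<^sup>L \<tau> g" using assms(3) by (intro integral_cong_AE) auto
  moreover have "AE \<theta> in \<tau>. 0 \<le> f \<theta>"
    using assms(1,3) unfolding prob_density_def by (auto elim: AE_mp)
  ultimately show "prob_density f" using assms by (simp add: prob_density_def)
  show "mean f = mean g"
    unfolding mean_def using assms(3) by (intro integral_cong_AE) (auto elim!: AE_mp)
qed

lemma PGM_exists:
  assumes "0 < s"
  shows "PGM \<tau> obj eta2 s (\<lambda>k. dens (weight s k))"
  unfolding PGM_def
  using is_arg_min_dens[OF assms] density_in_prob_measures_iff[of "dens 0"] prob_density_dens[of 0]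
  by (simp add: convex_indicator_def)

text \<open>Arbitrary iterates agree with the explicit ones almost everywhere only. The next
  proximal problem does not see the difference, so uniqueness of its minimiser carries the
  induction.\<close>

lemma PGM_unique:
  assumes s: "0 < s" and f: "PGM \<tau> obj eta2 s f" "f 0 = (\<lambda>_. 1)"
  shows "integrable \<tau> (f k) \<and> (AE \<theta> in \<tau>. f k \<theta> = dens (weight s k) \<theta>)"
proof (induction k)
  case 0
  then show ?case using f by (simp add: dens_0 PGM_def)
next
  case (Suc k)
  have A: "0 \<le> weight s k" using s by (intro weight_nonneg) simp
  note dens = prob_density_dens[OF A]
  note eq = prox_objective_cong_AE[OF prob_density_cong_AE(1)[OF dens] dens, of "f k"]
  have "is_arg_min (prox_objective \<tau> obj eta2 s (f k)) (integrable \<tau>) (f (Suc k))"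
    using f by (simp add: PGM_def)
  then have *: "is_arg_min (prox_objective \<tau> obj eta2 s (dens (weight s k))) (integrable \<tau>) (f (Suc k))"
    using eq Suc unfolding is_arg_min_def by (metis (no_types, lifting))
  then show ?case using is_arg_min_dens_unique[OF s *] by (auto simp: is_arg_min_def)
qed

lemma F_fun_PGM:
  assumes s: "0 < s" and f: "PGM \<tau> obj eta2 s f" "f 0 = (\<lambda>_. 1)"
  shows "F_fun \<tau> obj (f k) = ereal (mean (dens (weight s k)) ^ p / p)"
proof -
  have "0 \<le> weight s k" using s by (intro weight_nonneg) simp
  then show ?thesis
    using PGM_unique[OF assms, of k] prob_density_cong_AE[OF prob_density_dens, of "weight s k" "f k"]
    by (simp add: F_fun_obj)
qed

section \<open>Mean and level as functions of the weight\<close>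

abbreviation sublevel :: "real \<Rightarrow> 'a set" where
  "sublevel \<delta> \<equiv> {\<theta> \<in> space \<tau>. V \<theta> \<le> \<delta>}"

lemma sublevel_sets [measurable]: "sublevel \<delta> \<in> sets \<tau>"
  by measurable

lemma integral_indicator_sublevel:
  "integrable \<tau> (\<lambda>\<theta>. a * indicator (sublevel \<delta>) \<theta> :: real)"
  "(\<integral>\<theta>. a * indicator (sublevel \<delta>) \<theta> \<partial>\<tau>) = a * measure \<tau> (sublevel \<delta>)"
  by (auto simp: emeasure_eq_measure Int_absorb1 subset_iff)

text \<open>A Markov bound: mass 1 limits the height on a sublevel set. The upper bounds for the
  mean and for the level both rest on it.\<close>

lemma dens_mass_ge:
  assumes "0 \<le> A" "\<And>\<theta>. \<theta> \<in> sublevel \<delta> \<Longrightarrow> a \<le> dens A \<theta>"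
  shows "a * measure \<tau> (sublevel \<delta>) \<le> 1"
proof -
  have "(\<integral>\<theta>. a * indicator (sublevel \<delta>) \<theta> \<partial>\<tau>) \<le> integral\<^sup>L \<tau> (dens A)"
    by (rule integral_mono[OF integral_indicator_sublevel(1) integrable_dens])
      (use assms in \<open>auto simp: indicator_def\<close>)
  then show ?thesis using assms by (simp add: integral_indicator_sublevel integral_dens del: integral_mult_right_zero)
qed

lemma mean_dens_le_B: "0 \<le> A \<Longrightarrow> mean (dens A) \<le> B"
proof -
  assume "0 \<le> A"
  have "mean (dens A) \<le> (\<integral>\<theta>. B * dens A \<theta> \<partial>\<tau>)"
    unfolding mean_def by (intro integral_mono integrable_V_mult) (auto intro: mult_right_mono V_le)
  then show ?thesis using \<open>0 \<le> A\<close> by (simp add: integral_dens)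
qed

text \<open>The density is supported where \<open>A * V \<theta> \<le> level A\<close>; average this
  inequality against it.\<close>

lemma mean_dens_le_ratio: "0 \<le> A \<Longrightarrow> A * mean (dens A) \<le> level A"
proof -
  assume A: "0 \<le> A"
  have "(\<integral>\<theta>. A * (V \<theta> * dens A \<theta>) \<partial>\<tau>) \<le> (\<integral>\<theta>. level A * dens A \<theta> \<partial>\<tau>)"
  proof (intro integral_mono integrable_mult_right integrable_V_mult)
    fix \<theta> assume "\<theta> \<in> space \<tau>"
    have "A * V \<theta> * dens A \<theta> \<le> level A * dens A \<theta>"
      using dens_nonneg[of A \<theta>]
      by (cases "dens A \<theta> = 0") (auto simp: dens_def cut_def intro!: mult_right_mono)
    then show "A * (V \<theta> * dens A \<theta>) \<le> level A * dens A \<theta>" by (simp add: mult.assoc)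
  qed auto
  then show ?thesis using A by (simp add: integral_dens mean_def)
qed

text \<open>The decay exponent of the mean as a function of the weight, \<open>r / (d + r)\<close>
  on the torus.\<close>

definition \<alpha> :: real where "\<alpha> = 1 / (\<beta> + 1)"

lemma \<alpha>_pos: "0 < \<alpha>" using \<beta>_pos by (simp add: \<alpha>_def)

text \<open>With \<open>m\<close> the mean, the level is at least \<open>A * m\<close>, so the
  density is at least \<open>A * m / 2\<close> where \<open>V\<close> is at most
  \<open>m / 2\<close>. Mass 1 then bounds \<open>A * m powr (\<beta> + 1)\<close>.\<close>

lemma mean_dens_upper:
  assumes "0 < A"
  shows "mean (dens A) \<le> 2 * c1 powr - \<alpha> * A powr - \<alpha>"
proof -
  define m where "m = mean (dens A)"
  have m: "0 \<le> m" "m \<le> B" "A * m \<le> level A"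
    using assms mean_dens_nonneg mean_dens_le_B mean_dens_le_ratio by (auto simp: m_def)
  have "A * (m / 2) * measure \<tau> (sublevel (m / 2)) \<le> 1"
  proof (rule dens_mass_ge[of A])
    fix \<theta> assume "\<theta> \<in> sublevel (m / 2)"
    then have "A * V \<theta> \<le> A * (m / 2)" using assms by (intro mult_left_mono) auto
    then show "A * (m / 2) \<le> dens A \<theta>" using m(3) unfolding dens_def cut_def by linarith
  qed (use assms in simp)
  moreover have "A * (m / 2) * (c1 * (m / 2) powr \<beta>) \<le> A * (m / 2) * measure \<tau> (sublevel (m / 2))"
    using assms m by (intro mult_left_mono sublevel_lower) auto
  ultimately have "A * (m / 2) * (c1 * (m / 2) powr \<beta>) \<le> 1" by linarith
  moreover have "(m / 2) powr (\<beta> + 1) = (m / 2) * (m / 2) powr \<beta>"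
    using m by (simp add: powr_add)
  moreover have "A * (m / 2) * (c1 * (m / 2) powr \<beta>) = c1 * A * ((m / 2) * (m / 2) powr \<beta>)" by simp
  ultimately have "c1 * A * (m / 2) powr (\<beta> + 1) \<le> 1" by metis
  then have "(m / 2) powr (\<beta> + 1) \<le> 1 / (c1 * A)"
    using assms c1_pos by (simp add: field_simps)
  then have "((m / 2) powr (\<beta> + 1)) powr \<alpha> \<le> (1 / (c1 * A)) powr \<alpha>"
    using \<alpha>_pos by (intro powr_mono2) auto
  also have "((m / 2) powr (\<beta> + 1)) powr \<alpha> = m / 2"
    using m \<beta>_pos by (simp add: powr_powr \<alpha>_def)
  also have "(1 / (c1 * A)) powr \<alpha> = c1 powr - \<alpha> * A powr - \<alpha>"
    using assms c1_pos by (simp add: powr_divide powr_mult powr_minus field_simps)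
  finally show ?thesis by (simp add: m_def)
qed

text \<open>The density is at least half the level wherever \<open>A * V\<close> is at most half the
  level. The summands 1 keep the bound uniform down to \<open>A = 0\<close>.\<close>

lemma level_upper:
  assumes "0 \<le> A"
  shows "level A powr (\<beta> + 1) \<le> 2 powr (\<beta> + 1) * (1 + 1 / c1) * (1 + A) powr \<beta>"
proof -
  define l where "l = level A"
  have l: "0 < l" using level assms by (simp add: l_def)
  have one: "1 \<le> (1 + A) powr \<beta>" using assms \<beta>_pos by (simp add: ge_one_powr_ge_zero)
  have half: "l / 2 \<le> dens A \<theta>" if "A * V \<theta> \<le> l / 2" for \<theta>
    using that unfolding dens_def cut_def l_def by linarith
  show ?thesis
  \<comment> \<open>The volume estimate reaches up to \<open>B\<close> only. In the first case the
    density is at least \<open>l / 2\<close> on the whole space, so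
    \<open>l \<le> 2\<close>.\<close>
  proof (cases "A * B \<le> l / 2")
    case True
    have "l / 2 * measure \<tau> (sublevel B) \<le> 1"
    proof (rule dens_mass_ge[OF assms])
      fix \<theta> assume "\<theta> \<in> sublevel B"
      then have "A * V \<theta> \<le> A * B" using assms by (intro mult_left_mono) auto
      then show "l / 2 \<le> dens A \<theta>" using True by (intro half) linarith
    qed
    moreover have "sublevel B = space \<tau>" using V_le by auto
    ultimately have "l \<le> 2" by (simp add: mass)
    then have "l powr (\<beta> + 1) \<le> 2 powr (\<beta> + 1) * 1 * 1" using l \<beta>_pos by (simp add: powr_mono2)
    also have "\<dots> \<le> 2 powr (\<beta> + 1) * (1 + 1 / c1) * (1 + A) powr \<beta>"
      using one c1_pos by (intro mult_mono) auto
    finally show ?thesis by (simp add: l_def)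
  next
    case False
    then have A: "0 < A" using assms l B_pos by (cases "A = 0") auto
    define \<delta> where "\<delta> = l / (2 * A)"
    have \<delta>: "0 \<le> \<delta>" "\<delta> \<le> B" using l A False by (auto simp: \<delta>_def field_simps)
    have "l / 2 * measure \<tau> (sublevel \<delta>) \<le> 1"
    proof (rule dens_mass_ge[OF assms])
      fix \<theta> assume "\<theta> \<in> sublevel \<delta>"
      then have "A * V \<theta> \<le> A * \<delta>" using assms by (intro mult_left_mono) auto
      also have "\<dots> = l / 2" using A by (simp add: \<delta>_def)
      finally show "l / 2 \<le> dens A \<theta>" by (rule half)
    qed
    moreover have "l / 2 * (c1 * \<delta> powr \<beta>) \<le> l / 2 * measure \<tau> (sublevel \<delta>)"
      using l \<delta> by (intro mult_left_mono sublevel_lower) auto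
    ultimately have "l / 2 * (c1 * \<delta> powr \<beta>) \<le> 1" by linarith
    moreover have "l / 2 * (c1 * \<delta> powr \<beta>) = c1 * l powr (\<beta> + 1) / (2 powr (\<beta> + 1) * A powr \<beta>)"
      using l A by (simp add: \<delta>_def powr_divide powr_mult powr_add mult_ac)
    ultimately have "c1 * l powr (\<beta> + 1) / (2 powr (\<beta> + 1) * A powr \<beta>) \<le> 1" by metis
    then have "l powr (\<beta> + 1) \<le> 2 powr (\<beta> + 1) * (1 / c1) * A powr \<beta>"
      using c1_pos A by (simp add: field_simps)
    also have "\<dots> \<le> 2 powr (\<beta> + 1) * (1 + 1 / c1) * (1 + A) powr \<beta>"
      using c1_pos A \<beta>_pos by (intro mult_mono powr_mono2) auto
    finally show ?thesis by (simp add: l_def)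
  qed
qed

text \<open>Splitting the mass at \<open>V = \<delta>\<close> bounds it by \<open>level A * C2 * \<delta> powr \<beta> + mean (dens A) / \<delta>\<close>;
  \<open>\<delta>\<close> makes the first term one half.\<close>

lemma mean_dens_lower_level:
  assumes "0 \<le> A"
  shows "(2 * C2 * level A) powr (- 1 / \<beta>) / 2 \<le> mean (dens A)"
proof -
  define l where "l = level A"
  define \<delta> where "\<delta> = (2 * C2 * l) powr (- 1 / \<beta>)"
  have l: "0 < l" using level assms by (simp add: l_def)
  have \<delta>: "0 < \<delta>" using l C2_pos by (simp add: \<delta>_def)
  have "\<delta> powr \<beta> = 1 / (2 * C2 * l)"
    using l C2_pos \<beta>_pos unfolding \<delta>_def powr_powr by (simp add: powr_minus_divide)
  then have half: "l * (C2 * \<delta> powr \<beta>) = 1 / 2" using l C2_pos by simp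
  have "integral\<^sup>L \<tau> (dens A) \<le> (\<integral>\<theta>. l * indicator (sublevel \<delta>) \<theta> + 1 / \<delta> * (V \<theta> * dens A \<theta>) \<partial>\<tau>)"
  proof (intro integral_mono Bochner_Integration.integrable_add integral_indicator_sublevel
      integrable_mult_right integrable_V_mult integrable_dens)
    fix \<theta> assume \<theta>: "\<theta> \<in> space \<tau>"
    have le: "dens A \<theta> \<le> l" unfolding dens_def l_def using assms l \<theta> by (intro cut_le) (auto simp: l_def)
    show "dens A \<theta> \<le> l * indicator (sublevel \<delta>) \<theta> + 1 / \<delta> * (V \<theta> * dens A \<theta>)"
    proof (cases "V \<theta> \<le> \<delta>")
      case True
      have "0 \<le> 1 / \<delta> * (V \<theta> * dens A \<theta>)" using \<delta> V_nonneg[OF \<theta>] by simp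
      then show ?thesis using le True \<theta> by simp
    next
      case False
      then have "\<delta> * dens A \<theta> \<le> V \<theta> * dens A \<theta>" by (intro mult_right_mono) auto
      then show ?thesis using \<delta> False by (simp add: field_simps)
    qed
  qed
  also have "\<dots> = (\<integral>\<theta>. l * indicator (sublevel \<delta>) \<theta> \<partial>\<tau>) + (\<integral>\<theta>. 1 / \<delta> * (V \<theta> * dens A \<theta>) \<partial>\<tau>)"
    by (intro Bochner_Integration.integral_add integral_indicator_sublevel
      integrable_mult_right integrable_V_mult integrable_dens)
  also have "\<dots> = l * measure \<tau> (sublevel \<delta>) + mean (dens A) / \<delta>"
    unfolding integral_indicator_sublevel by (simp add: mean_def)
  also have "l * measure \<tau> (sublevel \<delta>) \<le> l * (C2 * \<delta> powr \<beta>)"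
    using l \<delta> by (intro mult_left_mono sublevel_upper) auto
  finally have "1 \<le> 1 / 2 + mean (dens A) / \<delta>" using assms by (simp add: half integral_dens)
  then have "1 / 2 \<le> mean (dens A) / \<delta>" by linarith
  then show ?thesis using \<delta> by (simp add: field_simps \<delta>_def l_def)
qed

text \<open>The level grows with exponent at most \<open>\<beta> * \<alpha>\<close>, and the mean is
  bounded below by its power \<open>- 1 / \<beta>\<close>; the exponents multiply to
  \<open>- \<alpha>\<close>.\<close>

lemma mean_dens_lower: "\<exists>c>0. \<forall>A\<ge>0. c * (1 + A) powr - \<alpha> \<le> mean (dens A)"
proof -
  define K where "K = 2 powr (\<beta> + 1) * (1 + 1 / c1)"
  have K: "0 < K" using c1_pos by (simp add: K_def add_pos_pos)
  define c where "c = (2 * C2 * K powr \<alpha>) powr (- 1 / \<beta>) / 2"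
  have "c * (1 + A) powr - \<alpha> \<le> mean (dens A)" if A: "0 \<le> A" for A
  proof -
    have l: "0 < level A" using level A by simp
    have "level A = (level A powr (\<beta> + 1)) powr \<alpha>"
      using l \<beta>_pos by (simp add: powr_powr \<alpha>_def)
    also have "\<dots> \<le> (K * (1 + A) powr \<beta>) powr \<alpha>"
      using level_upper[OF A] \<alpha>_pos by (intro powr_mono2) (auto simp: K_def)
    also have "\<dots> = K powr \<alpha> * (1 + A) powr (\<beta> * \<alpha>)"
      using K by (simp add: powr_mult powr_powr)
    finally have "2 * C2 * level A \<le> 2 * C2 * K powr \<alpha> * (1 + A) powr (\<beta> * \<alpha>)"
      using C2_pos by (simp add: mult.assoc)
    then have "(2 * C2 * K powr \<alpha> * (1 + A) powr (\<beta> * \<alpha>)) powr (- 1 / \<beta>)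
        \<le> (2 * C2 * level A) powr (- 1 / \<beta>)"
      using l C2_pos \<beta>_pos by (intro powr_mono2') auto
    moreover have "(2 * C2 * K powr \<alpha> * (1 + A) powr (\<beta> * \<alpha>)) powr (- 1 / \<beta>) = 2 * c * (1 + A) powr - \<alpha>"
      using C2_pos K \<beta>_pos A by (simp add: powr_mult powr_powr c_def)
    ultimately show ?thesis using mean_dens_lower_level[OF A] by linarith
  qed
  moreover have "0 < c" using C2_pos K by (simp add: c_def)
  ultimately show ?thesis by blast
qed

section \<open>Growth of the weight and the resulting rate\<close>

text \<open>A discrete form of the differential inequality with right-hand side
  \<open>s * C * A powr - (\<alpha> * (p - 1))\<close>, whose solutions grow at most like
  \<open>k powr \<gamma>\<close>.\<close>

lemma weight_upper:
  assumes s: "0 < s"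
  defines "\<gamma> \<equiv> 1 / (1 + \<alpha> * real (p - 1))"
  shows "\<exists>D>0. \<forall>k\<ge>1. weight s k \<le> D * real k powr \<gamma>"
proof -
  define C where "C = (2 * c1 powr - \<alpha>) ^ (p - 1)"
  have C: "0 \<le> C" by (simp add: C_def)
  \<comment> \<open>Controls the increment while the weight is small, where the power bound on the
    mean gives nothing useful.\<close>
  define M where "M = B ^ (p - 1)"
  have M: "0 \<le> M" using B_pos by (simp add: M_def)
  have \<gamma>: "0 < \<gamma>" "\<gamma> * (1 + \<alpha> * real (p - 1)) = 1"
    using \<alpha>_pos by (auto simp: \<gamma>_def add_pos_nonneg add_nonneg_eq_0_iff)
  have incr: "mean (dens A) ^ (p - 1) \<le> C * A powr - (\<alpha> * real (p - 1))" if "0 < A" for A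
  proof -
    have "mean (dens A) ^ (p - 1) \<le> (2 * c1 powr - \<alpha> * A powr - \<alpha>) ^ (p - 1)"
      using mean_dens_upper[OF that] mean_dens_nonneg by (intro power_mono)
    also have "\<dots> = C * A powr - (\<alpha> * real (p - 1))"
      using that by (simp add: C_def power_mult_distrib powr_power mult.commute)
    finally show ?thesis .
  qed
  \<comment> \<open>A threshold \<open>a\<close> replaces the differential inequality: a step that
    starts at or below \<open>a\<close> ends below \<open>a + s * M\<close> or at it, and a step
    that starts above adds at most the increment bound at \<open>a\<close>.\<close>
  have bound: "weight s j \<le> a + s * M + j * (s * C * a powr - (\<alpha> * real (p - 1)))" if a: "0 < a" for a j
  proof (induction j)
    case 0
    then show ?case using a s M by simp
  next
    case (Suc j)
    define w where "w = weight s j"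
    have w: "0 \<le> w" using s weight_nonneg by (simp add: w_def)
    define x where "x = s * C * a powr - (\<alpha> * real (p - 1))"
    have x: "0 \<le> x" using s C by (simp add: x_def)
    show ?case
    proof (cases "w \<le> a")
      case True
      have "s * mean (dens w) ^ (p - 1) \<le> s * M"
        using s w mean_dens_le_B mean_dens_nonneg unfolding M_def
        by (intro mult_left_mono power_mono) auto
      moreover have "0 \<le> real (Suc j) * x" using x by simp
      ultimately show ?thesis using True by (simp add: w_def x_def)
    next
      case False
      have "C * w powr - (\<alpha> * real (p - 1)) \<le> C * a powr - (\<alpha> * real (p - 1))"
        using False a C \<alpha>_pos by (intro mult_left_mono powr_mono2') auto
      then have "mean (dens w) ^ (p - 1) \<le> C * a powr - (\<alpha> * real (p - 1))"
        using incr[of w] False a by linarith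
      then have "s * mean (dens w) ^ (p - 1) \<le> x"
        using s mult_left_mono[of _ _ s] by (simp add: x_def mult.assoc)
      then show ?thesis using Suc by (simp add: w_def x_def algebra_simps)
    qed
  qed
  define D where "D = 1 + s * M + s * C"
  have "weight s k \<le> D * real k powr \<gamma>" if k: "1 \<le> k" for k
  proof -
    have kp: "0 < real k" "1 \<le> real k powr \<gamma>" using k \<gamma> by (auto simp: ge_one_powr_ge_zero)
    \<comment> \<open>The threshold \<open>k powr \<gamma>\<close> balances both contributions:
      \<open>k\<close> increments at that height add up to a multiple of
      \<open>k powr \<gamma>\<close> again, by the choice of \<open>\<gamma>\<close>.\<close>
    have "real k * (real k powr \<gamma>) powr - (\<alpha> * real (p - 1)) = real k powr (1 - \<gamma> * (\<alpha> * real (p - 1)))"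
      using kp(1) by (simp add: powr_powr powr_diff powr_minus_divide)
    also have "1 - \<gamma> * (\<alpha> * real (p - 1)) = \<gamma>" using \<gamma>(2) by (simp add: algebra_simps)
    finally have e: "real k * (real k powr \<gamma>) powr - (\<alpha> * real (p - 1)) = real k powr \<gamma>" .
    have "weight s k \<le> real k powr \<gamma> + s * M
        + s * C * (real k * (real k powr \<gamma>) powr - (\<alpha> * real (p - 1)))"
      using bound[of "real k powr \<gamma>" k] kp by (simp add: mult_ac)
    also have "\<dots> \<le> real k powr \<gamma> + s * M * real k powr \<gamma> + s * C * real k powr \<gamma>"
      unfolding e using kp s M by (simp add: mult_left_mono[of 1 "real k powr \<gamma>" "s * M", simplified])
    finally show ?thesis by (simp add: D_def algebra_simps)
  qed
  moreover have "0 < D" using s M C by (simp add: D_def add_pos_nonneg)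
  ultimately show ?thesis by blast
qed

lemma rate_lower:
  assumes s: "0 < s"
  shows "\<exists>c>0. \<forall>k\<ge>1. c * real k powr - (real p / (\<beta> + real p))
    \<le> mean (dens (weight s k)) ^ p / p"
proof -
  define \<gamma> where "\<gamma> = 1 / (1 + \<alpha> * real (p - 1))"
  have \<gamma>: "0 < \<gamma>" using \<alpha>_pos by (simp add: \<gamma>_def add_pos_nonneg)
  obtain D where D: "0 < D" "\<And>k. 1 \<le> k \<Longrightarrow> weight s k \<le> D * real k powr \<gamma>"
    using weight_upper[OF s] unfolding \<gamma>_def by blast
  obtain c where c: "0 < c" "\<And>A. 0 \<le> A \<Longrightarrow> c * (1 + A) powr - \<alpha> \<le> mean (dens A)"
    using mean_dens_lower by blast
  \<comment> \<open>\<open>\<gamma> * \<alpha>\<close> simplifies to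
    \<open>1 / (\<beta> + p)\<close>.\<close>
  have expo: "\<gamma> * \<alpha> * real p = real p / (\<beta> + real p)"
    using \<beta>_pos p by (auto simp: \<gamma>_def \<alpha>_def field_simps)
  define c' where "c' = (c * (1 + D) powr - \<alpha>) ^ p / p"
  have "c' * real k powr - (real p / (\<beta> + real p)) \<le> mean (dens (weight s k)) ^ p / p" if k: "1 \<le> k" for k
  proof -
    have kp: "0 < real k" "1 \<le> real k powr \<gamma>" using k \<gamma> by (auto simp: ge_one_powr_ge_zero)
    define A where "A = weight s k"
    have A: "0 \<le> A" using s weight_nonneg by (simp add: A_def)
    have "1 + A \<le> (1 + D) * real k powr \<gamma>" using D(2)[OF k] kp by (simp add: A_def algebra_simps)
    then have "((1 + D) * real k powr \<gamma>) powr - \<alpha> \<le> (1 + A) powr - \<alpha>"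
      using A \<alpha>_pos by (intro powr_mono2') auto
    then have "c * ((1 + D) * real k powr \<gamma>) powr - \<alpha> \<le> c * (1 + A) powr - \<alpha>"
      using c(1) by (intro mult_left_mono) auto
    also have "\<dots> \<le> mean (dens A)" by (rule c(2)[OF A])
    finally have "c * (1 + D) powr - \<alpha> * real k powr - (\<gamma> * \<alpha>) \<le> mean (dens A)"
      using D(1) by (simp add: powr_mult powr_powr mult.assoc)
    then have "(c * (1 + D) powr - \<alpha> * real k powr - (\<gamma> * \<alpha>)) ^ p \<le> mean (dens A) ^ p"
      using c(1) by (intro power_mono) auto
    then have "(c * (1 + D) powr - \<alpha>) ^ p * real k powr - (\<gamma> * \<alpha> * real p) \<le> mean (dens A) ^ p"
      using kp(1) by (simp add: power_mult_distrib powr_power mult_ac)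
    then have "(c * (1 + D) powr - \<alpha>) ^ p * real k powr - (\<gamma> * \<alpha> * real p) / p \<le> mean (dens A) ^ p / p"
      by (rule divide_right_mono) simp
    then show ?thesis unfolding expo by (simp add: c'_def A_def)
  qed
  moreover have "0 < c'" using c D p_pos by (simp add: c'_def)
  ultimately show ?thesis by blast
qed

text \<open>The densities with integer slopes form a minimising sequence, because
  \<open>mean_dens_upper\<close> sends their means to 0.\<close>

lemma inf_F_eq_0: "inf_F \<tau> obj = 0"
proof (rule antisym)
  have F: "inf_F \<tau> obj \<le> ereal ((2 * c1 powr - \<alpha> * real n powr - \<alpha>) ^ p / p)" if "1 \<le> n" for n :: nat
  proof -
    have "inf_F \<tau> obj \<le> F_fun \<tau> obj (dens (real n))"
      unfolding inf_F_def by (rule INF_lower) simp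
    also have "\<dots> = ereal (mean (dens (real n)) ^ p / p)"
      by (simp add: F_fun_obj prob_density_dens)
    also have "\<dots> \<le> ereal ((2 * c1 powr - \<alpha> * real n powr - \<alpha>) ^ p / p)"
      using mean_dens_upper[of "real n"] mean_dens_nonneg[of "real n"] that
      by (simp add: divide_right_mono power_mono)
    finally show ?thesis .
  qed
  have "(\<lambda>n. real n powr - \<alpha>) \<longlonglongrightarrow> 0"
    using \<alpha>_pos by (intro tendsto_neg_powr filterlim_real_sequentially) auto
  then have "(\<lambda>n. (2 * c1 powr - \<alpha> * real n powr - \<alpha>) ^ p / p) \<longlonglongrightarrow> (2 * c1 powr - \<alpha> * 0) ^ p / p"
    using p_pos by (intro tendsto_intros) auto
  then have "(\<lambda>n. ereal ((2 * c1 powr - \<alpha> * real n powr - \<alpha>) ^ p / p)) \<longlonglongrightarrow>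
      ereal ((2 * c1 powr - \<alpha> * 0) ^ p / p)"
    by (rule tendsto_ereal)
  moreover have "ereal ((2 * c1 powr - \<alpha> * 0) ^ p / p) = 0" using p_pos by simp
  ultimately have "(\<lambda>n. ereal ((2 * c1 powr - \<alpha> * real n powr - \<alpha>) ^ p / p)) \<longlonglongrightarrow> 0" by metis
  then show "inf_F \<tau> obj \<le> 0"
    by (rule LIMSEQ_le_const) (use F in blast)
qed (rule inf_F_nonneg)

lemma PGM_lower_bound:
  assumes s: "0 < s" and f: "PGM \<tau> obj eta2 s f" "f 0 = (\<lambda>_. 1)"
  shows "\<exists>c>0. \<forall>k\<ge>1. ereal (c * real k powr - (real p / (\<beta> + real p)))
    \<le> F_fun \<tau> obj (f k) - inf_F \<tau> obj"
  using rate_lower[OF s] by (simp add: F_fun_PGM[OF assms] inf_F_eq_0)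

text \<open>The Dirac mass, written as a set function, reaches the infimum over densities. For
  \<open>p = 2\<close> the gradient there carries the integral of \<open>V\<close> as a factor,
  which is 0.\<close>

lemma minimizer_exists:
  assumes \<theta>: "\<theta>0 \<in> space \<tau>" "V \<theta>0 = 0"
  defines "\<mu> \<equiv> \<lambda>A. indicator A \<theta>0 :: real"
  shows "signed_measure \<tau> \<mu>" "F_bar \<tau> obj \<mu> = inf_F \<tau> obj"
    "p = 2 \<Longrightarrow> G_bar_diff \<tau> obj \<mu> \<theta> = 0"
proof -
  \<comment> \<open>Pushing forward a one-point measure gives \<open>N\<close> exactly the
    sigma-algebra of \<open>\<tau>\<close>.\<close>
  define N where "N = distr (count_space {()}) \<tau> (\<lambda>_. \<theta>0)"
  have meas: "(\<lambda>_. \<theta>0) \<in> measurable (count_space {()}) \<tau>" using \<theta> by simp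
  have em: "emeasure N A = indicator A \<theta>0" if "A \<in> sets \<tau>" for A
    unfolding N_def using that
    by (subst emeasure_distr[OF meas]) (auto simp: indicator_def emeasure_count_space)
  have N: "finite_measure N" "sets N = sets \<tau>" "\<And>A. A \<in> sets \<tau> \<Longrightarrow> \<mu> A = measure N A"
  proof -
    show "sets N = sets \<tau>" by (simp add: N_def)
    have "space N = space \<tau>" by (simp add: N_def)
    then show "finite_measure N" by (intro finite_measureI) (simp add: em \<theta>)
    show "\<mu> A = measure N A" if "A \<in> sets \<tau>" for A
      using em[OF that] by (simp add: measure_def \<mu>_def indicator_def)
  qed
  show sm: "signed_measure \<tau> \<mu>" by (rule signed_measure_of_measure) (fact N)+
  have [measurable]: "feature obj \<in> borel_measurable \<tau>" by (simp add: obj_def)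
  have "signed_integral \<tau> \<mu> (feature obj) = integral\<^sup>L N (feature obj)"
    by (rule signed_integral_of_measure) (fact N)+
  also have "\<dots> = feature obj \<theta>0"
    unfolding N_def by (subst integral_distr[OF meas]) (auto simp: lebesgue_integral_count_space_finite)
  finally have z: "signed_integral \<tau> \<mu> (feature obj) = 0" by (simp add: \<theta>)
  have sp: "space S = space \<tau>" using sets_S by (rule sets_eq_imp_space_eq)
  have "signed_measure S \<mu>" using sm by (simp add: signed_measure_def sets_S)
  then have "\<mu> \<in> prob_measures S"
    using \<theta> by (simp add: prob_measures_def nonneg_measures_def \<mu>_def sp)
  then show "F_bar \<tau> obj \<mu> = inf_F \<tau> obj"
    using p_pos by (simp add: F_bar_def G_bar_def z ray_loss_def convex_indicator_def inf_F_eq_0)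
  show "G_bar_diff \<tau> obj \<mu> \<theta> = 0" if "p = 2"
  proof -
    have "0 < p - 1" using that by simp
    then show ?thesis by (simp add: G_bar_diff_def z gradient_ray_loss[OF p_pos])
  qed
qed

end

section \<open>The potential on the torus\<close>

text \<open>Jordan's inequality: by concavity the chord from 0 to \<open>pi / 2\<close> lies below
  the graph.\<close>

lemma sin_ge_linear:
  assumes "0 \<le> u" "u \<le> 1/2"
  shows "2 * u \<le> sin (pi * u)"
proof -
  have "concave_on {0..pi} (sin :: real \<Rightarrow> real)"
    by (rule f''_le0_imp_concave[where f' = cos and f'' = "\<lambda>x. - sin x"])
      (auto intro!: derivative_eq_intros sin_ge_zero)
  from concave_onD[OF this, of "2 * u" 0 "pi / 2"] show ?thesis
    using assms by (simp add: mult.commute)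
qed

text \<open>Moves the zero at 1/2 to the origin of the sine, so that one linear bound serves on both
  sides of it.\<close>

lemma abs_cos_eq_abs_sin: "\<bar>cos (pi * t)\<bar> = \<bar>sin (pi * \<bar>t - 1/2\<bar>)\<bar>" for t :: real
proof -
  have "cos (pi * t) = cos (pi * (t - 1/2) + pi / 2)" by (simp add: algebra_simps)
  also have "\<dots> = - sin (pi * (t - 1/2))" by (simp add: cos_add)
  finally have "\<bar>cos (pi * t)\<bar> = \<bar>sin (pi * (t - 1/2))\<bar>" by simp
  also have "\<dots> = \<bar>sin (pi * \<bar>t - 1/2\<bar>)\<bar>"
  proof (cases "0 \<le> t - 1/2")
    case False
    then have "\<bar>t - 1/2\<bar> = - (t - 1/2)" by linarith
    then have "sin (pi * \<bar>t - 1/2\<bar>) = - sin (pi * (t - 1/2))"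
      by (simp only: mult_minus_right sin_minus)
    then show ?thesis by simp
  qed (simp only: abs_of_nonneg)
  finally show ?thesis .
qed

lemma abs_cos_lower:
  assumes "0 \<le> t" "t \<le> 1"
  shows "2 * \<bar>t - 1/2\<bar> \<le> \<bar>cos (pi * t)\<bar>"
proof -
  have "\<bar>t - 1/2\<bar> \<le> 1/2" using assms by linarith
  then show ?thesis
    using sin_ge_linear[of "\<bar>t - 1/2\<bar>"] unfolding abs_cos_eq_abs_sin by linarith
qed

lemma abs_cos_upper: "\<bar>cos (pi * t)\<bar> \<le> pi * \<bar>t - 1/2\<bar>" for t :: real
  unfolding abs_cos_eq_abs_sin using abs_sin_x_le_abs_x[of "pi * \<bar>t - 1/2\<bar>"] by (simp add: abs_mult)

lemma abs_cos_frac: "\<bar>cos (pi * frac t)\<bar> = \<bar>cos (pi * t)\<bar>" for t :: real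
proof -
  have "cos (pi * t) = cos (pi * frac t + pi * of_int \<lfloor>t\<rfloor>)" by (simp add: frac_def algebra_simps)
  also have "\<bar>\<dots>\<bar> = \<bar>cos (pi * frac t)\<bar>" by (simp add: cos_add abs_mult)
  finally show ?thesis by simp
qed

lemma abs_cos_diff_le: "\<bar>cos a - cos b\<bar> \<le> \<bar>a - b\<bar>" for a b :: real
proof -
  have "\<bar>cos a - cos b\<bar> = 2 * (\<bar>sin ((a + b) / 2)\<bar> * \<bar>sin ((b - a) / 2)\<bar>)"
    by (simp add: cos_diff_cos abs_mult)
  also have "\<dots> \<le> 2 * (1 * \<bar>(b - a) / 2\<bar>)"
    by (intro mult_left_mono mult_mono abs_sin_x_le_abs_x abs_sin_le_one) auto
  finally show ?thesis by simp
qed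

lemma abs_sin_diff_le: "\<bar>sin a - sin b\<bar> \<le> \<bar>a - b\<bar>" for a b :: real
  using abs_cos_diff_le[of "a - pi / 2" "b - pi / 2"] by (simp add: cos_diff)

section \<open>The periodic potential and its regularity\<close>

text \<open>The absolute value gives period 1, so the sum descends to the torus. Its zero is the
  centre of the cell, so small boxes around it stay away from the faces; \<open>r\<close> is the
  order of vanishing.\<close>

definition cos_potential :: "nat \<Rightarrow> real^'n \<Rightarrow> real" where
  "cos_potential r x = (\<Sum>i\<in>UNIV. \<bar>cos (pi * x $ i)\<bar> ^ r)"

lemma cos_potential_frac [simp]: "cos_potential r (frac_vec x) = cos_potential r x"
  by (simp add: cos_potential_def frac_vec_def abs_cos_frac)

lemma continuous_cos_potential: "continuous_on S (cos_potential r)"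
  unfolding cos_potential_def[abs_def] by (intro continuous_intros)

lemma cos_potential_nonneg: "0 \<le> cos_potential r x"
  by (simp add: cos_potential_def sum_nonneg)

lemma cos_potential_le: "cos_potential r (x :: real^'n) \<le> real CARD('n)"
proof -
  have "cos_potential r x \<le> (\<Sum>i\<in>(UNIV :: 'n set). 1)"
    unfolding cos_potential_def by (intro sum_mono power_le_one) auto
  then show ?thesis by simp
qed

lemma cos_potential_center: "0 < r \<Longrightarrow> cos_potential r (\<chi> i. 1/2) = 0"
  by (simp add: cos_potential_def)

lemma cos_potential_continuous_map: "continuous_map torus_topology euclidean (cos_potential r)"
  by (rule continuous_map_torus) (simp add: continuous_cos_potential)

lemma cos_potential_measurable [measurable]: "cos_potential r \<in> borel_measurable torus_measure"
  using measurable_torus[OF cos_potential_continuous_map]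
    measurable_cong_sets[OF sets_torus_measure refl] by blast

lemma cos_potential_Lipschitz:
  "\<bar>cos_potential 1 x - cos_potential 1 y\<bar> \<le> real CARD('n) * pi * dist x (y :: real^'n)"
proof -
  have "\<bar>cos_potential 1 x - cos_potential 1 y\<bar> \<le> (\<Sum>i\<in>UNIV. \<bar>\<bar>cos (pi * x $ i)\<bar> - \<bar>cos (pi * y $ i)\<bar>\<bar>)"
    unfolding cos_potential_def power_one_right sum_subtractf[symmetric] by (rule sum_abs)
  also have "\<dots> \<le> (\<Sum>i\<in>(UNIV :: 'n set). pi * dist x y)"
  proof (rule sum_mono)
    fix i
    have "\<bar>\<bar>cos (pi * x $ i)\<bar> - \<bar>cos (pi * y $ i)\<bar>\<bar> \<le> \<bar>pi * x $ i - pi * y $ i\<bar>"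
      using abs_cos_diff_le[of "pi * x $ i" "pi * y $ i"] by linarith
    also have "\<dots> = pi * \<bar>(x - y) $ i\<bar>" by (simp add: abs_mult right_diff_distrib[symmetric])
    also have "\<dots> \<le> pi * dist x y"
      unfolding dist_norm by (intro mult_left_mono component_le_norm_cart) auto
    finally show "\<bar>\<bar>cos (pi * x $ i)\<bar> - \<bar>cos (pi * y $ i)\<bar>\<bar> \<le> pi * dist x y" .
  qed
  finally show ?thesis by simp
qed

definition cos_potential_grad :: "real^'n \<Rightarrow> real^'n" where
  "cos_potential_grad x = (\<chi> i. - pi * sin (2 * pi * x $ i))"

text \<open>For exponent 2 the absolute value disappears, and the double angle formula yields a
  Lipschitz gradient.\<close>

lemma cos_potential_has_derivative:
  "(cos_potential 2 has_derivative (\<lambda>v. cos_potential_grad x \<bullet> v)) (at x)"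
proof -
  have "((\<lambda>y. (cos (pi * y $ i))\<^sup>2) has_derivative (\<lambda>v. - pi * sin (2 * pi * x $ i) * v $ i)) (at x)" for i
  proof -
    have "sin (2 * pi * x $ i) = 2 * sin (pi * x $ i) * cos (pi * x $ i)"
      using sin_double[of "pi * x $ i"] by (simp add: mult.assoc)
    then show ?thesis
      by (auto intro!: derivative_eq_intros bounded_linear.has_derivative[OF bounded_linear_vec_nth]
          simp: fun_eq_iff power2_eq_square)
  qed
  then have "((\<lambda>y. \<Sum>i\<in>UNIV. (cos (pi * y $ i))\<^sup>2) has_derivative
      (\<lambda>v. \<Sum>i\<in>UNIV. - pi * sin (2 * pi * x $ i) * v $ i)) (at x)"
    by (intro has_derivative_sum) auto
  then show ?thesis
    by (simp add: cos_potential_def[abs_def] cos_potential_grad_def inner_vec_def)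
qed

lemma cos_potential_grad_Lipschitz:
  "norm (cos_potential_grad x - cos_potential_grad (y :: real^'n)) \<le> real CARD('n) * (2 * pi\<^sup>2) * dist x y"
proof -
  have "norm (cos_potential_grad x - cos_potential_grad y)
      \<le> (\<Sum>i\<in>UNIV. \<bar>(cos_potential_grad x - cos_potential_grad y) $ i\<bar>)"
    by (rule norm_le_l1_cart)
  also have "\<dots> \<le> (\<Sum>i\<in>(UNIV :: 'n set). 2 * pi\<^sup>2 * dist x y)"
  proof (rule sum_mono)
    fix i
    have "\<bar>(cos_potential_grad x - cos_potential_grad y) $ i\<bar>
        = pi * \<bar>sin (2 * pi * x $ i) - sin (2 * pi * y $ i)\<bar>"
      by (simp add: cos_potential_grad_def right_diff_distrib[symmetric] abs_mult abs_minus_commute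
          del: minus_diff_eq)
    also have "\<dots> \<le> pi * \<bar>2 * pi * x $ i - 2 * pi * y $ i\<bar>"
      by (intro mult_left_mono abs_sin_diff_le) auto
    also have "\<dots> = 2 * pi\<^sup>2 * \<bar>(x - y) $ i\<bar>"
      by (simp add: abs_mult right_diff_distrib[symmetric] power2_eq_square)
    also have "\<dots> \<le> 2 * pi\<^sup>2 * dist x y"
      unfolding dist_norm by (intro mult_left_mono component_le_norm_cart) auto
    finally show "\<bar>(cos_potential_grad x - cos_potential_grad y) $ i\<bar> \<le> 2 * pi\<^sup>2 * dist x y" .
  qed
  finally show ?thesis by (simp add: mult.assoc)
qed

text \<open>Chart inverses are \<open>frac_vec\<close>, under which the potential is invariant, so
  its Euclidean derivative serves in every chart.\<close>

lemma Lipschitz_derivative_cos_potential: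
  "Lipschitz_derivative (torus :: (real^'n, 'n) manifold) (\<lambda>x. cos_potential 2 x *\<^sub>R unit_ell2)"
  unfolding Lipschitz_derivative_def
proof
  fix c :: "(real^'n, 'n) chart" assume "c \<in> charts torus"
  then obtain a where c: "c = torus_chart a" by auto
  define D :: "real^'n \<Rightarrow> (real^'n) \<Rightarrow>\<^sub>L ell2" where
    "D x = Blinfun (\<lambda>v. (cos_potential_grad x \<bullet> v) *\<^sub>R unit_ell2)" for x
  have D: "blinfun_apply (D x) v = (cos_potential_grad x \<bullet> v) *\<^sub>R unit_ell2" for x v
    unfolding D_def by (subst bounded_linear_Blinfun_apply) (auto intro!: bounded_linear_intros)
  show "\<exists>D :: real^'n \<Rightarrow> (real^'n) \<Rightarrow>\<^sub>L ell2.
      (\<forall>x\<in>chart_image c. (((\<lambda>x. cos_potential 2 x *\<^sub>R unit_ell2) \<circ> chart_inv c)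
         has_derivative blinfun_apply (D x)) (at x)) \<and>
      (\<forall>K. compact K \<and> K \<subseteq> chart_image c \<longrightarrow> (\<exists>L. L-lipschitz_on K D))"
  proof (intro exI[of _ D] conjI ballI allI impI)
    fix x assume "x \<in> chart_image c"
    then have x: "x \<in> unit_cube a" by (simp add: c)
    have "((\<lambda>x. cos_potential 2 x *\<^sub>R unit_ell2) has_derivative
        (\<lambda>v. (cos_potential_grad x \<bullet> v) *\<^sub>R unit_ell2)) (at x)"
      by (intro has_derivative_scaleR_left cos_potential_has_derivative)
    then have "((\<lambda>x. cos_potential 2 x *\<^sub>R unit_ell2) has_derivative blinfun_apply (D x)) (at x)"
      by (simp add: D[abs_def])
    then show "(((\<lambda>x. cos_potential 2 x *\<^sub>R unit_ell2) \<circ> chart_inv c) has_derivative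
        blinfun_apply (D x)) (at x)"
      by (rule has_derivative_transform_within_open[OF _ open_unit_cube x])
        (simp add: c chart_inv_torus)
  next
    fix K :: "(real^'n) set"
    have "(real CARD('n) * (2 * pi\<^sup>2))-lipschitz_on K D"
    proof (rule lipschitz_onI)
      fix x y :: "real^'n"
      have "norm (D x - D y) \<le> norm (cos_potential_grad x - cos_potential_grad y)"
      proof (rule norm_blinfun_bound)
        fix v
        have "norm (blinfun_apply (D x - D y) v) = \<bar>(cos_potential_grad x - cos_potential_grad y) \<bullet> v\<bar>"
          by (simp add: blinfun.diff_left D inner_diff_left flip: scaleR_left_diff_distrib)
        also have "\<dots> \<le> norm (cos_potential_grad x - cos_potential_grad y) * norm v"
          by (rule Cauchy_Schwarz_ineq2)
        finally show "norm (blinfun_apply (D x - D y) v)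
            \<le> norm (cos_potential_grad x - cos_potential_grad y) * norm v" .
      qed simp
      then show "dist (D x) (D y) \<le> real CARD('n) * (2 * pi\<^sup>2) * dist x y"
        using cos_potential_grad_Lipschitz[of x y] by (simp add: dist_norm)
    qed simp
    then show "\<exists>L. L-lipschitz_on K D" ..
  qed
qed

section \<open>Volumes of sublevel sets\<close>

lemma measure_torus_bounds:
  fixes h :: "real^'n"
  defines "h \<equiv> \<chi> i. 1/2"
  assumes A: "A \<in> sets (torus_measure :: (real^'n) measure)" and \<rho>: "0 \<le> \<rho>"
  shows "A \<subseteq> cbox (h - (\<chi> i. \<rho>)) (h + (\<chi> i. \<rho>)) \<Longrightarrow> measure torus_measure A \<le> (2 * \<rho>) ^ CARD('n)"
    and "box (h - (\<chi> i. \<rho>)) (h + (\<chi> i. \<rho>)) \<subseteq> A \<Longrightarrow> (2 * \<rho>) ^ CARD('n) \<le> measure torus_measure A"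
proof -
  let ?a = "h - (\<chi> i. \<rho>)" and ?b = "h + (\<chi> i. \<rho>)"
  have A': "A \<in> sets (manifold_borel (torus :: (real^'n, 'n) manifold))"
    using A by (simp add: sets_torus_measure)
  have fin: "emeasure lborel A = ennreal (measure torus_measure A)"
  proof -
    have "emeasure torus_measure A \<le> 1"
      using emeasure_space[of torus_measure A] unfolding emeasure_torus_space .
    then show ?thesis
      unfolding emeasure_torus[OF A', symmetric]
      by (intro emeasure_eq_ennreal_measure) (auto simp: top_unique)
  qed
  have box: "emeasure lborel (cbox ?a ?b) = ennreal ((2 * \<rho>) ^ CARD('n))"
    "emeasure lborel (box ?a ?b) = ennreal ((2 * \<rho>) ^ CARD('n))"
    using \<rho> by (simp_all add: emeasure_lborel_cart)
  show "A \<subseteq> cbox ?a ?b \<Longrightarrow> measure torus_measure A \<le> (2 * \<rho>) ^ CARD('n)"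
    using emeasure_mono[of A "cbox ?a ?b" lborel] \<rho> unfolding box fin by simp
  show "box ?a ?b \<subseteq> A \<Longrightarrow> (2 * \<rho>) ^ CARD('n) \<le> measure torus_measure A"
    using emeasure_mono[of "box ?a ?b" A lborel] borel_of_torus[OF A'] unfolding box fin by simp
qed

lemma powr_inverse_power:
  assumes "0 \<le> x" "0 < n"
  shows "(x powr (1 / a)) ^ n = x powr (real n / a)"
proof (cases "x = 0")
  case False
  then have "(x powr (1 / a)) ^ n = (x powr (1 / a)) powr real n"
    by (subst powr_realpow) auto
  then show ?thesis by (simp add: powr_powr)
qed (use assms in simp)

text \<open>A sublevel set lies between two boxes around the centre of the cell; the constants are
  read off their volumes.\<close>

lemma power_potential_torus:
  assumes r: "0 < r" and p: "p \<in> {1, 2}"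
  shows "power_potential torus_measure (manifold_borel (torus :: (real^'n, 'n) manifold))
    (cos_potential r) (real CARD('n)) p
    ((2 / pi) ^ CARD('n) * real CARD('n) powr - (real CARD('n) / r)) 1 (real CARD('n) / r)"
proof -
  let ?d = "real CARD('n)"
  interpret finite_measure "torus_measure :: (real^'n) measure"
    by (rule finite_measureI) (simp add: emeasure_torus_space del: space_torus_measure)
  show ?thesis
  proof
    show "measure torus_measure (space (torus_measure :: (real^'n) measure)) = 1"
      unfolding measure_def emeasure_torus_space by simp
    show "sets (manifold_borel (torus :: (real^'n, 'n) manifold)) = sets torus_measure"
      by (simp add: sets_torus_measure)
    show "cos_potential r \<in> borel_measurable (torus_measure :: (real^'n) measure)" by measurable
    fix \<delta> :: real assume \<delta>: "0 \<le> \<delta>"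
    let ?S = "{x \<in> space torus_measure. cos_potential r (x :: real^'n) \<le> \<delta>}"
    have S: "?S \<in> sets torus_measure" by measurable
    {
      \<comment> \<open>Each summand of the potential is at most \<open>\<delta>\<close>, and
        \<open>abs_cos_lower\<close> turns this into a distance of at most \<open>\<rho>\<close>
        from 1/2 in every coordinate.\<close>
      define \<rho> where "\<rho> = \<delta> powr (1 / r) / 2"
      have "?S \<subseteq> cbox ((\<chi> i. 1/2) - (\<chi> i. \<rho>)) ((\<chi> i. 1/2) + (\<chi> i. \<rho>))"
      proof (clarsimp simp: mem_box_cart)
        fix x :: "real^'n" and i assume x: "x \<in> unit_cell" "cos_potential r x \<le> \<delta>"
        define u where "u = 2 * \<bar>x $ i - 1/2\<bar>"
        have "u ^ r \<le> \<bar>cos (pi * x $ i)\<bar> ^ r"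
          using x abs_cos_lower[of "x $ i"] unfolding u_def
          by (intro power_mono) (auto simp: unit_cell_def less_imp_le)
        also have "\<dots> \<le> cos_potential r x"
          unfolding cos_potential_def by (rule member_le_sum) auto
        also have "\<dots> \<le> \<delta>" by fact
        finally have "(u ^ r) powr (1 / r) \<le> \<delta> powr (1 / r)"
          by (intro powr_mono2) (auto simp: u_def)
        moreover have "(u ^ r) powr (1 / r) = u"
        proof -
          have "0 \<le> u" by (simp add: u_def)
          then show ?thesis
            using r by (cases "u = 0") (simp_all add: powr_powr flip: powr_realpow)
        qed
        ultimately have "\<bar>x $ i - 1/2\<bar> \<le> \<rho>" by (simp add: u_def \<rho>_def)
        then show "1/2 - \<rho> \<le> x $ i \<and> x $ i \<le> 1/2 + \<rho>" by (auto simp: abs_le_iff)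
      qed
      then have "measure torus_measure ?S \<le> (2 * \<rho>) ^ CARD('n)"
        using measure_torus_bounds(1)[OF S, of \<rho>] by (simp add: \<rho>_def)
      then show "measure torus_measure ?S \<le> 1 * \<delta> powr (?d / r)"
        using \<delta> by (simp add: \<rho>_def powr_inverse_power)
    }
    {
      assume le: "\<delta> \<le> ?d"
      \<comment> \<open>Each of the \<open>d\<close> summands may use the share
        \<open>\<delta> / d\<close>, which \<open>abs_cos_upper\<close> grants within this radius.
        As \<open>\<delta> \<le> d\<close>, the radius is at most \<open>1 / pi\<close>, hence below
        1/2, and the box stays in the cell.\<close>
      define \<rho> where "\<rho> = (\<delta> / ?d) powr (1 / r) / pi"
      have "(\<delta> / ?d) powr (1 / r) \<le> 1 powr (1 / r)"
        using \<delta> le by (intro powr_mono2) auto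
      then have "\<rho> \<le> 1 / pi" unfolding \<rho>_def by (intro divide_right_mono) auto
      also have "1 / pi < 1 / 2" using pi_gt3 by (simp add: field_simps)
      finally have \<rho>: "0 \<le> \<rho>" "\<rho> < 1/2" by (auto simp: \<rho>_def)
      have pow: "(pi * \<rho>) ^ r = \<delta> / ?d"
        using r \<delta> by (simp add: \<rho>_def powr_inverse_power)
      have "box ((\<chi> i. 1/2) - (\<chi> i. \<rho>)) ((\<chi> i. 1/2) + (\<chi> i. \<rho>)) \<subseteq> ?S"
      proof
        fix x :: "real^'n" assume "x \<in> box ((\<chi> i. 1/2) - (\<chi> i. \<rho>)) ((\<chi> i. 1/2) + (\<chi> i. \<rho>))"
        then have x: "1/2 - \<rho> < x $ i" "x $ i < 1/2 + \<rho>" for i by (auto simp: mem_box_cart)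
        have "0 \<le> x $ i \<and> x $ i < 1" for i using x[of i] \<rho> by linarith
        moreover have "\<bar>cos (pi * x $ i)\<bar> ^ r \<le> \<delta> / ?d" for i
        proof -
          have "\<bar>x $ i - 1/2\<bar> \<le> \<rho>" using x[of i] by (auto simp: abs_le_iff)
          then have "pi * \<bar>x $ i - 1/2\<bar> \<le> pi * \<rho>" by simp
          then have "\<bar>cos (pi * x $ i)\<bar> \<le> pi * \<rho>" using abs_cos_upper[of "x $ i"] by linarith
          then show ?thesis unfolding pow[symmetric] by (intro power_mono) auto
        qed
        then have "cos_potential r x \<le> (\<Sum>i\<in>(UNIV :: 'n set). \<delta> / ?d)"
          unfolding cos_potential_def by (intro sum_mono) auto
        ultimately show "x \<in> ?S" by (auto simp: unit_cell_def)
      qed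
      then have "(2 * \<rho>) ^ CARD('n) \<le> measure torus_measure ?S"
        using measure_torus_bounds(2)[OF S \<rho>(1)] by simp
      moreover have "(2 * \<rho>) ^ CARD('n) = (2 / pi) ^ CARD('n) * ((\<delta> / ?d) powr (1 / r)) ^ CARD('n)"
        by (simp add: \<rho>_def power_mult_distrib power_divide)
      moreover have "((\<delta> / ?d) powr (1 / r)) ^ CARD('n) = ?d powr - (?d / r) * \<delta> powr (?d / r)"
      proof -
        have "((\<delta> / ?d) powr (1 / r)) ^ CARD('n) = (\<delta> / ?d) powr (?d / r)"
          using \<delta> by (intro powr_inverse_power) auto
        then show ?thesis using \<delta> by (simp add: powr_divide powr_minus_divide)
      qed
      ultimately show "(2 / pi) ^ CARD('n) * ?d powr - (?d / r) * \<delta> powr (?d / r) \<le> measure torus_measure ?S"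
        by (simp only: mult.assoc)
    }
  next
    show "p \<in> {1, 2}" by (rule p)
    show "0 < ?d" "0 < (1 :: real)" "0 < ?d / r" using r by simp_all
    show "0 < (2 / pi) ^ CARD('n) * ?d powr - (?d / r)" by (intro mult_pos_pos) simp_all
  qed (rule cos_potential_nonneg cos_potential_le)+
qed

section \<open>The four settings\<close>

text \<open>Exponent 2 makes the differential vanish at the optimum, as the starred settings
  demand.\<close>

primrec loss_power :: "setting \<Rightarrow> nat" where
  "loss_power Setting_I = 1"
| "loss_power Setting_I_star = 2"
| "loss_power Setting_II = 1"
| "loss_power Setting_II_star = 2"

text \<open>The absolute value of the cosine is Lipschitz but has a corner at its zero; its square
  is smooth.\<close>

primrec potential_power :: "setting \<Rightarrow> nat" where
  "potential_power Setting_I = 1"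
| "potential_power Setting_I_star = 1"
| "potential_power Setting_II = 2"
| "potential_power Setting_II_star = 2"

theorem proposition5p3:
  fixes T :: setting
  shows "\<exists>(M :: (real^'n, 'n::finite) manifold) \<tau> (P :: (real^'n, ell2) objective).
    compact_riemannian_manifold M \<and> normalized_volume M \<tau> \<and>
    assumption_A1 M P \<and> in_setting T M \<tau> P \<and>
    (\<forall>s>0. (\<exists>f. PGM \<tau> P eta2 s f \<and> f 0 = (\<lambda>_. 1)) \<and>
       (\<forall>f. PGM \<tau> P eta2 s f \<and> f 0 = (\<lambda>_. 1) \<longrightarrow>
          (\<exists>c>0. \<forall>k\<ge>1.
             ereal (c * real k powr (- real (rate T) / (real CARD('n) + real (rate T))))
               \<le> F_fun \<tau> P (f k) - inf_F \<tau> P)))"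
proof -
  define p r where "p = loss_power T" and "r = potential_power T"
  have p: "p \<in> {1, 2}" and r: "r \<in> {1, 2}" and rate: "rate T = p * r"
    by (cases T; simp add: p_def r_def)+
  let ?d = "real CARD('n)"
  have r0: "0 < r" using r by auto
  interpret power_potential torus_measure "manifold_borel (torus :: (real^'n, 'n) manifold)"
    "cos_potential r" ?d p "(2 / pi) ^ CARD('n) * ?d powr - (?d / r)" 1 "?d / r"
    by (rule power_potential_torus[OF r0 p])
  have "continuous_map torus_topology euclidean (\<lambda>x :: real^'n. cos_potential r x *\<^sub>R unit_ell2)"
    by (rule continuous_map_torus) (simp, intro continuous_intros continuous_cos_potential)
  moreover have "regularizer (manifold_borel torus) (reg obj)"
    unfolding regularizer_def
    by (rule exI[of _ "[convex_indicator (prob_measures (manifold_borel torus))]"])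
      (simp add: elementary_regularizers_def fun_eq_iff)
  ultimately have A1: "assumption_A1 torus obj"
    unfolding assumption_A1_def
    using convex_ray_loss[OF p] GDERIV_ray_loss[OF p_pos] gradient_ray_loss[OF p_pos]
      Lipschitz_gradient_ray_loss[OF p]
    by (auto simp: obj_def)
  have center: "(\<chi> i. 1/2) \<in> space (torus_measure :: (real^'n) measure)"
    by (simp add: unit_cell_def)
  note minimizer = minimizer_exists[OF center cos_potential_center[OF r0]]
  have star: "p = 2" if "T \<in> {Setting_I_star, Setting_II_star}" using that by (auto simp: p_def)
  have feature: "feature obj = (\<lambda>x. cos_potential r x *\<^sub>R unit_ell2)"
    by (simp add: fun_eq_iff)
  have "if T \<in> {Setting_I, Setting_I_star} then Lipschitz_map torus (feature obj)
      else Lipschitz_derivative torus (feature obj)"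
  proof (cases "T \<in> {Setting_I, Setting_I_star}")
    case True
    then have "r = 1" by (auto simp: r_def)
    then have "Lipschitz_map torus (feature obj)"
      unfolding feature using cos_potential_Lipschitz[where ?'n = 'n]
      by (intro Lipschitz_map_torus[where L = "?d * pi"])
        (simp_all add: dist_norm flip: scaleR_left_diff_distrib)
    then show ?thesis using True by simp
  next
    case False
    then have "r = 2" by (cases T) (auto simp: r_def)
    then have "Lipschitz_derivative torus (feature obj)"
      unfolding feature using Lipschitz_derivative_cos_potential by simp
    then show ?thesis using False by simp
  qed
  then have "in_setting T torus torus_measure obj"
    unfolding in_setting_def using minimizer star by blast
  moreover have "\<exists>f. PGM torus_measure obj eta2 s f \<and> f 0 = (\<lambda>_. 1)" if "0 < s" for s
    using PGM_exists[OF that] by (intro exI[of _ "\<lambda>k. dens (weight s k)"]) (simp add: dens_0)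
  \<comment> \<open>Expanding \<open>p / (d / r + p)\<close> by \<open>r\<close> produces
    \<open>q = p * r\<close>.\<close>
  moreover have "- (real p / (?d / r + real p)) = - real (rate T) / (?d + real (rate T))"
    using r0 by (simp add: rate field_simps)
  ultimately show ?thesis
    using compact_riemannian_manifold_torus normalized_volume_torus A1 PGM_lower_bound
    by (intro exI[of _ torus] exI[of _ torus_measure] exI[of _ obj]) simp
qed

end
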